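(* The phase dimension of Bessel functions is equal to $4/3$; that is, for every $\nu\in\mathbb{R}$ and every $\tau_0>0$, if $x:[\tau_0,\infty)\to\mathbb{R}$ is $x(t)=J_\nu(t)$ or $x(t)=Y_\nu(t)$, then $$\dim_{ph}(x)=\dim_B\{(x(t),\dot x(t)):t\in[\tau_0,\infty)\}=\frac43 .$$
   Context: $J_\nu$ and $Y_\nu$ are the Bessel functions of the first and second kind of order $\nu$, solutions of $t^2x''(t)+tx'(t)+(t^2-\nu^2)x(t)=0$. Phase dimension: for $x:[t_0,\infty)\to\mathbb{R}$ of class $C^1$, $\dim_{ph}(x)$ is the box dimension of the planar curve $\{(x(t),\dot x(t)):t\in[t_0,\infty)\}$. Box dimension: for bounded $A\subset\mathbb{R}^N$ let $A_\varepsilon=\{y\in\mathbb{R}^N: d(y,A)<\varepsilon\}$, and let $|A_\varepsilon|$ denote its Lebesgue measure. For $s\ge0$ let $\mathcal{M}_*^s(A)=\liminf_{\varepsilon\to0}|A_\varepsilon|/\varepsilon^{N-s}$ and $\mathcal{M}^{*s}(A)=\limsup_{\varepsilon\to0}|A_\varepsilon|/\varepsilon^{N-s}$. Then $\underline{\dim}_BA=\inf\{s\ge0:\mathcal{M}_*^s(A)=0\}$ and $\overline{\dim}_BA=\inf\{s\ge0:\mathcal{M}^{*s}(A)=0\}$; if they coincide the common value is $\dim_BA$. *)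

theory Defs
  imports "HOL-Analysis.Analysis"
begin

text \<open>
  The Bessel functions are considered on the positive half-line only. The reciprocal
  Gamma function vanishes at the nonpositive integers, so the series for \<open>J\<close> is meaningful
  for every real order.
\<close>

definition bessel_J :: "real \<Rightarrow> real \<Rightarrow> real" where
  "bessel_J \<nu> t =
     (\<Sum>m. (- 1) ^ m * rGamma (real m + \<nu> + 1) / fact m * (t / 2) powr (2 * real m + \<nu>))"

text \<open>At integer orders, \<open>Y\<close> is the limit of the defining quotient with respect to the order.\<close>

definition bessel_Y :: "real \<Rightarrow> real \<Rightarrow> real" where
  "bessel_Y \<nu> t =
     (if \<nu> \<in> \<int>
      then Lim (at \<nu>) (\<lambda>\<mu>. (bessel_J \<mu> t * cos (\<mu> * pi) - bessel_J (- \<mu>) t) / sin (\<mu> * pi))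
      else (bessel_J \<nu> t * cos (\<nu> * pi) - bessel_J (- \<nu>) t) / sin (\<nu> * pi))"

text \<open>
  \<open>\<exists>a\<in>A. dist y a < \<epsilon>\<close> says that the distance from \<open>y\<close> to \<open>A\<close> is less than \<open>\<epsilon>\<close>;
  unlike \<open>infdist y A < \<epsilon>\<close> it is also correct for empty \<open>A\<close>.
\<close>

definition eps_nbhd :: "real \<Rightarrow> 'a::metric_space set \<Rightarrow> 'a set" where
  "eps_nbhd \<epsilon> A = {y. \<exists>a\<in>A. dist y a < \<epsilon>}"

definition lower_minkowski_content :: "real \<Rightarrow> 'a::euclidean_space set \<Rightarrow> ennreal" where
  "lower_minkowski_content s A =
     Liminf (at_right 0)
       (\<lambda>\<epsilon>. emeasure lebesgue (eps_nbhd \<epsilon> A) / ennreal (\<epsilon> powr (real DIM('a) - s)))"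

definition upper_minkowski_content :: "real \<Rightarrow> 'a::euclidean_space set \<Rightarrow> ennreal" where
  "upper_minkowski_content s A =
     Limsup (at_right 0)
       (\<lambda>\<epsilon>. emeasure lebesgue (eps_nbhd \<epsilon> A) / ennreal (\<epsilon> powr (real DIM('a) - s)))"

definition lower_box_dim :: "'a::euclidean_space set \<Rightarrow> ereal" where
  "lower_box_dim A = (INF s\<in>{s. 0 \<le> s \<and> lower_minkowski_content s A = 0}. ereal s)"

definition upper_box_dim :: "'a::euclidean_space set \<Rightarrow> ereal" where
  "upper_box_dim A = (INF s\<in>{s. 0 \<le> s \<and> upper_minkowski_content s A = 0}. ereal s)"

text \<open>
  Since the box dimension need not exist, it is a relation rather than a function,
  and likewise for the phase dimension below.
\<close>

definition has_box_dim :: "'a::euclidean_space set \<Rightarrow> real \<Rightarrow> bool" where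
  "has_box_dim A d \<longleftrightarrow> bounded A \<and> lower_box_dim A = ereal d \<and> upper_box_dim A = ereal d"

text \<open>
  Derivatives are taken within \<open>{t\<^sub>0..}\<close>, hence are one-sided at \<open>t\<^sub>0\<close>, so that everything
  depends only on the restriction of \<open>x\<close> to \<open>{t\<^sub>0..}\<close>.
\<close>

definition C1_on_ray :: "real \<Rightarrow> (real \<Rightarrow> real) \<Rightarrow> bool" where
  "C1_on_ray t\<^sub>0 x \<longleftrightarrow>
     x differentiable_on {t\<^sub>0..} \<and>
     continuous_on {t\<^sub>0..} (\<lambda>t. vector_derivative x (at t within {t\<^sub>0..}))"

definition phase_curve :: "real \<Rightarrow> (real \<Rightarrow> real) \<Rightarrow> (real \<times> real) set" where
  "phase_curve t\<^sub>0 x = (\<lambda>t. (x t, vector_derivative x (at t within {t\<^sub>0..}))) ` {t\<^sub>0..}"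

definition has_phase_dim :: "real \<Rightarrow> (real \<Rightarrow> real) \<Rightarrow> real \<Rightarrow> bool" where
  "has_phase_dim t\<^sub>0 x d \<longleftrightarrow> C1_on_ray t\<^sub>0 x \<and> has_box_dim (phase_curve t\<^sub>0 x) d"

end

theory Submission
  imports Defs
begin

text \<open>
  Write \<open>x\<close> for a nonzero solution of the Bessel equation. The substitution \<open>u = sqrt t * x\<close> removes
  the first-order term and leaves \<open>u'' + (1 + \<kappa> / t\<^sup>2) * u = 0\<close> with \<open>\<kappa> = 1/4 - \<nu>\<^sup>2\<close>, a harmonic
  oscillator with an integrable perturbation. Hence \<open>u\<close> is a pure oscillation up to \<open>O(1/t)\<close>, and
  \<open>(x, x') = R / sqrt t * (cos (t - \<delta>), - sin (t - \<delta>))\<close> up to an error of order \<open>1 / (t * sqrt t)\<close>, with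
  \<open>R > 0\<close> (lemma \<open>solves_bessel_asymptotics\<close>). The phase curve is thus a spiral of radius \<open>R / sqrt t\<close>,
  and its consecutive turns at time \<open>t\<close> are about \<open>1 / (t * sqrt t)\<close> apart, which is also the size of
  the error.

  The turns lie closer together than \<open>\<epsilon>\<close> once \<open>t\<close> exceeds a multiple of \<open>\<epsilon> powr (- 2 / 3)\<close>, where
  the radius is of order \<open>\<epsilon> powr (1 / 3)\<close>. From there on the \<open>\<epsilon>\<close>-neighbourhood fills a disc of area
  of order \<open>\<epsilon> powr (2 / 3)\<close>: every point \<open>p\<close> close to the origin has distance \<open>O(norm p ^ 3)\<close> from the
  curve (lemma \<open>spiral_near_point\<close>). The part before that time has length of order
  \<open>sqrt t = \<epsilon> powr (- 1 / 3)\<close>, so its neighbourhood has area of order \<open>\<epsilon> powr (2 / 3)\<close> as well (lemma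
  \<open>lebesgue_curve_nbhd_le\<close>). Since \<open>2 / 3 = 2 - 4 / 3\<close>, the box dimension is \<open>4 / 3\<close> (lemma
  \<open>has_box_dimI\<close>).

  It remains to see that \<open>J\<close> and \<open>Y\<close> are nonzero solutions for every real order. For \<open>J\<close> the defining
  series gives both. At an integer order \<open>Y\<close> is a combination of derivatives of \<open>J\<close> with respect to
  the order. The series may be differentiated term by term in the order, and the derivative solves a
  Bessel equation with a forcing term proportional to \<open>J\<close>; the reflection formula
  \<open>J\<^sub>-\<^sub>n = (- 1) ^ n * J\<^sub>n\<close> makes the forcing terms cancel in \<open>Y\<close>. That \<open>Y\<close> does not vanish
  identically is read off from its behaviour near \<open>t = 0\<close>.
\<close>

section \<open>Box dimension from the size of neighbourhoods\<close>

lemma open_eps_nbhd: "open (eps_nbhd \<epsilon> A)"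
proof -
  have "eps_nbhd \<epsilon> A = (\<Union>a\<in>A. ball a \<epsilon>)"
    by (auto simp: eps_nbhd_def dist_commute)
  then show ?thesis by auto
qed

text \<open>
  Two-sided bounds by the same power \<open>\<epsilon> powr (N - d)\<close> make the Minkowski contents positive for
  \<open>s \<le> d\<close> and zero for \<open>s > d\<close>, so both infima are \<open>d\<close>.
\<close>

lemma has_box_dimI:
  fixes A :: "'a::euclidean_space set" and c d K :: real
  assumes "bounded A" "0 < c" "0 \<le> d"
    and lo: "\<forall>\<^sub>F \<epsilon> in at_right 0. ennreal (c * \<epsilon> powr (real DIM('a) - d)) \<le> emeasure lebesgue (eps_nbhd \<epsilon> A)"
    and up: "\<forall>\<^sub>F \<epsilon> in at_right 0. emeasure lebesgue (eps_nbhd \<epsilon> A) \<le> ennreal (K * \<epsilon> powr (real DIM('a) - d))"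
  shows "has_box_dim A d"
proof -
  have pos: "\<forall>\<^sub>F \<epsilon>::real in at_right 0. 0 < \<epsilon> \<and> \<epsilon> < 1"
    by (auto simp: eventually_at_right_field intro!: exI[of _ 1])
  have low: "d < s" if "0 \<le> s" "lower_minkowski_content s A = 0" for s
  proof (rule ccontr)
    assume "\<not> d < s"
    have "\<forall>\<^sub>F \<epsilon> in at_right 0. ennreal c \<le>
        emeasure lebesgue (eps_nbhd \<epsilon> A) / ennreal (\<epsilon> powr (real DIM('a) - s))"
      using lo pos
    proof eventually_elim
      case (elim \<epsilon>)
      have "\<epsilon> powr (real DIM('a) - s) \<le> \<epsilon> powr (real DIM('a) - d)"
        using elim \<open>\<not> d < s\<close> by (intro powr_mono') auto
      then have "ennreal c \<le> ennreal (c * \<epsilon> powr (real DIM('a) - d) / \<epsilon> powr (real DIM('a) - s))"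
        using elim \<open>0 < c\<close> by (intro ennreal_leI) (auto simp: field_simps)
      also have "\<dots> = ennreal (c * \<epsilon> powr (real DIM('a) - d)) / ennreal (\<epsilon> powr (real DIM('a) - s))"
        using elim \<open>0 < c\<close> by (intro divide_ennreal[symmetric]) auto
      also have "\<dots> \<le> emeasure lebesgue (eps_nbhd \<epsilon> A) / ennreal (\<epsilon> powr (real DIM('a) - s))"
        using elim by (intro divide_right_mono_ennreal) auto
      finally show ?case .
    qed
    then have "ennreal c \<le> lower_minkowski_content s A"
      unfolding lower_minkowski_content_def by (rule Liminf_bounded)
    with that \<open>0 < c\<close> show False by simp
  qed
  have upp: "upper_minkowski_content s A = 0" if "d < s" for s
  proof -
    have "\<forall>\<^sub>F \<epsilon> in at_right 0. emeasure lebesgue (eps_nbhd \<epsilon> A) / ennreal (\<epsilon> powr (real DIM('a) - s))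
       \<le> ennreal (K * \<epsilon> powr (s - d))"
      using up pos
    proof eventually_elim
      case (elim \<epsilon>)
      have "emeasure lebesgue (eps_nbhd \<epsilon> A) / ennreal (\<epsilon> powr (real DIM('a) - s))
          \<le> ennreal (K * \<epsilon> powr (real DIM('a) - d)) / ennreal (\<epsilon> powr (real DIM('a) - s))"
        using elim by (intro divide_right_mono_ennreal) auto
      also have "\<dots> \<le> ennreal (K * \<epsilon> powr (real DIM('a) - d) / \<epsilon> powr (real DIM('a) - s))"
      proof (cases "K \<ge> 0")
        case True
        then show ?thesis using elim by (subst divide_ennreal) auto
      next
        case False
        then have "K * \<epsilon> powr (real DIM('a) - d) \<le> 0" by (simp add: mult_nonpos_nonneg)
        then show ?thesis by (simp add: ennreal_neg)
      qed
      also have "K * \<epsilon> powr (real DIM('a) - d) / \<epsilon> powr (real DIM('a) - s) = K * \<epsilon> powr (s - d)"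
        using elim by (simp add: powr_diff field_simps)
      finally show ?case .
    qed
    moreover have "((\<lambda>\<epsilon>. ennreal (K * \<epsilon> powr (s - d))) \<longlongrightarrow> ennreal (K * 0)) (at_right 0)"
    proof (intro tendsto_ennrealI tendsto_mult tendsto_const)
      show "((\<lambda>\<epsilon>::real. \<epsilon> powr (s - d)) \<longlongrightarrow> 0) (at_right 0)"
        using that by (intro tendsto_eq_intros refl tendsto_powr2[where a=0, simplified] | auto simp: eventually_at_right_less eventually_mono[OF eventually_at_right_less])+
    qed
    then have "Limsup (at_right 0) (\<lambda>\<epsilon>. ennreal (K * \<epsilon> powr (s - d))) = 0"
      by (intro lim_imp_Limsup) simp_all
    ultimately have "upper_minkowski_content s A \<le> 0"
      unfolding upper_minkowski_content_def by (auto dest: Limsup_mono)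
    then show ?thesis by simp
  qed
  have lower_le: "lower_minkowski_content s A = 0" if "upper_minkowski_content s A = 0" for s
  proof -
    have "lower_minkowski_content s A \<le> upper_minkowski_content s A"
      unfolding lower_minkowski_content_def upper_minkowski_content_def
      by (intro Liminf_le_Limsup) simp
    then show ?thesis using that by simp
  qed
  have "ereal d \<le> lower_box_dim A"
    unfolding lower_box_dim_def by (intro INF_greatest) (use low in force)
  moreover have "lower_box_dim A \<le> upper_box_dim A"
    unfolding lower_box_dim_def upper_box_dim_def
    by (intro INF_superset_mono) (use lower_le in auto)
  moreover have "upper_box_dim A \<le> ereal d"
  proof (rule ereal_le_epsilon2)
    fix e :: real assume "0 < e"
    then have "upper_box_dim A \<le> ereal (d + e)"
      unfolding upper_box_dim_def using upp[of "d + e"] \<open>0 \<le> d\<close> by (intro INF_lower) auto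
    then show "upper_box_dim A \<le> ereal d + ereal e" by simp
  qed
  ultimately show ?thesis
    using \<open>bounded A\<close> unfolding has_box_dim_def by auto
qed

section \<open>Neighbourhoods of spirals that wind in like the inverse square root of the angle\<close>

text \<open>
  The radii of \<open>1 / sqrt t\<close> within one turn after \<open>q\<^sup>2\<close> differ by the spacing of the spiral. This is
  Taylor's theorem for \<open>sqrt\<close> at \<open>q\<^sup>2\<close>, with the explicit bound \<open>sqrt t \<le> q + pi / q\<close>.
\<close>

lemma inverse_sqrt_gap:
  fixes q t :: real
  assumes "0 < q" "q\<^sup>2 \<le> t" "t \<le> q\<^sup>2 + 2 * pi"
  shows "\<bar>1 / q - 1 / sqrt t\<bar> \<le> pi / q ^ 3"
proof -
  have qt: "q \<le> sqrt t" using assms by (simp add: real_le_rsqrt)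
  have "t \<le> (q + pi / q)\<^sup>2"
    using assms by (simp add: power2_sum) (smt (verit) zero_le_power2)
  then have "sqrt t \<le> q + pi / q"
    using assms by (intro real_le_lsqrt) auto
  then have "sqrt t - q \<le> pi / q" by simp
  moreover have "q * q \<le> q * sqrt t" using qt assms by simp
  ultimately have "(sqrt t - q) / (q * sqrt t) \<le> (pi / q) / (q * q)"
    using qt assms by (intro frac_le) auto
  moreover have "1 / q - 1 / sqrt t = (sqrt t - q) / (q * sqrt t)"
    using qt assms by (subst diff_frac_eq) auto
  moreover have "0 \<le> (sqrt t - q) / (q * sqrt t)"
    using qt assms by (intro divide_nonneg_nonneg mult_nonneg_nonneg) linarith+
  ultimately show ?thesis by (simp add: power3_eq_cube)
qed

lemma norm_Pair_le_sum: "norm (a, b) \<le> \<bar>a\<bar> + \<bar>b\<bar>" for a b :: real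
  using sqrt_sum_squares_le_sum_abs[of a b] by (simp add: norm_Pair)

text \<open>
  Along the exact spiral the direction of \<open>p\<close> is met once in every time interval of length \<open>2 * pi\<close>.
  Take the first such time after the moment \<open>(R / norm p)\<^sup>2\<close> at which the spiral has radius \<open>norm p\<close>:
  the radial discrepancy and the error of the approximation are then both cubic in \<open>norm p\<close>.
\<close>

lemma spiral_near_point:
  fixes f g :: "real \<Rightarrow> real"
  assumes "0 < R"
    and f: "\<And>t. t \<ge> \<tau> \<Longrightarrow> \<bar>f t - R * cos (t - \<delta>) / sqrt t\<bar> \<le> C / (t * sqrt t)"
    and g: "\<And>t. t \<ge> \<tau> \<Longrightarrow> \<bar>g t + R * sin (t - \<delta>) / sqrt t\<bar> \<le> C / (t * sqrt t)"
    and "0 < \<tau>" and p: "p \<noteq> 0" "norm p \<le> R / sqrt \<tau>"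
  shows "\<exists>t\<ge>\<tau>. dist p (f t, g t) \<le> 2 * (R * pi + C) / R ^ 3 * norm p ^ 3"
proof -
  obtain p1 p2 where pp: "p = (p1, p2)" by (cases p)
  define \<rho> where "\<rho> = norm p"
  have \<rho>: "\<rho> > 0" using p by (simp add: \<rho>_def)
  have "(p1 / \<rho>)\<^sup>2 + (p2 / \<rho>)\<^sup>2 = (p1\<^sup>2 + p2\<^sup>2) / \<rho>\<^sup>2"
    by (simp add: power_divide add_divide_distrib)
  also have "\<rho>\<^sup>2 = p1\<^sup>2 + p2\<^sup>2" by (simp add: \<rho>_def pp norm_Pair)
  also have "(p1\<^sup>2 + p2\<^sup>2) / (p1\<^sup>2 + p2\<^sup>2) = 1" using \<rho> \<open>\<rho>\<^sup>2 = p1\<^sup>2 + p2\<^sup>2\<close> by auto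
  finally obtain \<phi> where "p1 / \<rho> = cos \<phi>" "p2 / \<rho> = sin \<phi>" by (metis sincos_total_2pi)
  then have p12: "p1 = \<rho> * cos \<phi>" "p2 = \<rho> * sin \<phi>" using \<rho> by (auto simp: field_simps)
  \<comment> \<open>the square root of the time at which the exact spiral has radius \<open>\<rho>\<close>\<close>
  define q where "q = R / \<rho>"
  have q: "q > 0" using \<rho> \<open>0 < R\<close> by (simp add: q_def)
  \<comment> \<open>the number of full turns that moves \<open>t\<close> into the first turn after \<open>q\<^sup>2\<close>\<close>
  define k where "k = \<lceil>(q\<^sup>2 + \<phi> - \<delta>) / (2 * pi)\<rceil>"
  define t where "t = \<delta> - \<phi> + 2 * pi * of_int k"
  have "(q\<^sup>2 + \<phi> - \<delta>) / (2 * pi) \<le> of_int k" "of_int k < (q\<^sup>2 + \<phi> - \<delta>) / (2 * pi) + 1"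
    unfolding k_def by linarith+
  then have "q\<^sup>2 + \<phi> - \<delta> \<le> of_int k * (2 * pi)" "of_int k * (2 * pi) < q\<^sup>2 + \<phi> - \<delta> + 2 * pi"
    by (simp_all add: field_simps)
  then have t: "q\<^sup>2 \<le> t" "t \<le> q\<^sup>2 + 2 * pi" by (simp_all add: t_def algebra_simps)
  have "\<rho> * sqrt \<tau> \<le> R" using p(2) \<open>0 < \<tau>\<close> by (simp add: \<rho>_def field_simps)
  then have "sqrt \<tau> \<le> q" using \<rho> by (simp add: q_def field_simps)
  then have "\<tau> \<le> q\<^sup>2" by (simp add: sqrt_le_D)
  with t have t\<tau>: "t \<ge> \<tau>" by simp
  have t0: "t > 0" using t\<tau> \<open>0 < \<tau>\<close> by simp
  have "t - \<delta> = - \<phi> + 2 * pi * of_int k" by (simp add: t_def)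
  then have ang: "cos (t - \<delta>) = cos \<phi>" "sin (t - \<delta>) = - sin \<phi>"
    by (simp_all only: cos_add sin_add cos_int_2pin sin_int_2pin) simp_all
  have gap: "\<bar>\<rho> - R / sqrt t\<bar> \<le> R * (pi / q ^ 3)"
  proof -
    have "\<rho> - R / sqrt t = R * (1 / q - 1 / sqrt t)"
      using \<open>0 < R\<close> \<rho> by (simp add: q_def field_simps)
    then show ?thesis
      using mult_left_mono[OF inverse_sqrt_gap[OF q t], of R] \<open>0 < R\<close> by (simp add: abs_mult)
  qed
  have Cpos: "0 \<le> C" using f[OF t\<tau>] t0 by (smt (verit) divide_neg_pos mult_pos_pos real_sqrt_gt_zero)
  have "q \<le> sqrt t" using t q by (simp add: real_le_rsqrt)
  then have "q\<^sup>2 * q \<le> t * sqrt t" using t q t0 by (intro mult_mono) auto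
  then have err: "C / (t * sqrt t) \<le> C / q ^ 3"
    using Cpos q t0 by (intro divide_left_mono) (auto simp: power3_eq_cube power2_eq_square)
  have comp: "\<bar>\<rho> * x - y\<bar> \<le> (R * pi + C) / q ^ 3"
    if x: "\<bar>x\<bar> \<le> 1" and y: "\<bar>y - R * x / sqrt t\<bar> \<le> C / (t * sqrt t)" for x y
  proof -
    have "\<bar>\<rho> * x - R * x / sqrt t\<bar> = \<bar>\<rho> - R / sqrt t\<bar> * \<bar>x\<bar>"
      by (simp add: abs_mult[symmetric] algebra_simps)
    also have "\<dots> \<le> R * (pi / q ^ 3) * 1" using gap x by (intro mult_mono) auto
    finally show ?thesis using y err by (simp add: add_divide_distrib) 
  qed
  have 1: "\<bar>\<rho> * cos \<phi> - f t\<bar> \<le> (R * pi + C) / q ^ 3"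
    using f[OF t\<tau>] by (intro comp) (auto simp: ang)
  have 2: "\<bar>\<rho> * sin \<phi> - g t\<bar> \<le> (R * pi + C) / q ^ 3"
    using g[OF t\<tau>] by (intro comp) (auto simp: ang)
  have "dist p (f t, g t) \<le> \<bar>p1 - f t\<bar> + \<bar>p2 - g t\<bar>"
    unfolding dist_norm pp by (simp add: norm_Pair_le_sum)
  also have "\<dots> \<le> 2 * ((R * pi + C) / q ^ 3)" using 1 2 unfolding p12 by linarith
  also have "\<dots> = 2 * (R * pi + C) / R ^ 3 * \<rho> ^ 3" by (simp add: q_def power_divide)
  finally show ?thesis using t\<tau> unfolding \<rho>_def by blast
qed

lemma emeasure_lebesgue_disc:
  fixes p :: "real \<times> real"
  assumes "0 \<le> r"
  shows "emeasure lebesgue (ball p r) = ennreal (pi * r\<^sup>2)"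
  using emeasure_ball[OF assms, of p] by (simp add: unit_ball_vol_2 power2_eq_square)

text \<open>
  In the parameter \<open>s = sqrt t\<close> the curve has bounded speed. Up to \<open>s = \<epsilon> powr (- 1 / 3)\<close> it is covered
  by \<open>O(\<epsilon> powr (- 4 / 3))\<close> discs of radius \<open>O(\<epsilon>)\<close>; afterwards the decay keeps it inside a single disc of
  radius \<open>O(\<epsilon> powr (1 / 3))\<close>. The exponent \<open>- 1 / 3\<close> balances the two areas.
\<close>

lemma lebesgue_curve_nbhd_le:
  fixes \<gamma> :: "real \<Rightarrow> real \<times> real"
  assumes "0 < \<tau>" "0 \<le> B" "0 \<le> L"
    and B: "\<And>t. t \<ge> \<tau> \<Longrightarrow> norm (\<gamma> t) \<le> B / sqrt t"
    and L: "\<And>s r. s \<ge> sqrt \<tau> \<Longrightarrow> r \<ge> sqrt \<tau> \<Longrightarrow> dist (\<gamma> (s\<^sup>2)) (\<gamma> (r\<^sup>2)) \<le> L * \<bar>s - r\<bar>"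
    and \<epsilon>: "0 < \<epsilon>" "\<epsilon> < 1"
  shows "emeasure lebesgue (eps_nbhd \<epsilon> (\<gamma> ` {\<tau>..}))
    \<le> ennreal (pi * ((B + 1)\<^sup>2 + 3 * (L + 1)\<^sup>2) * \<epsilon> powr (2 / 3))"
proof -
  define s0 where "s0 = sqrt \<tau>"
  define N where "N = nat \<lceil>\<epsilon> powr (- 4 / 3)\<rceil>"
  define c where "c k = \<gamma> ((s0 + real k * \<epsilon>)\<^sup>2)" for k
  define r where "r = B * \<epsilon> powr (1 / 3) + \<epsilon>"
  have s0: "s0 > 0" using \<open>0 < \<tau>\<close> by (simp add: s0_def)
  have r0: "0 \<le> r" using \<epsilon> \<open>0 \<le> B\<close> by (simp add: r_def)
  have cover: "eps_nbhd \<epsilon> (\<gamma> ` {\<tau>..}) \<subseteq> ball 0 r \<union> (\<Union>k\<le>N. ball (c k) ((L + 1) * \<epsilon>))"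
  proof
    fix y assume "y \<in> eps_nbhd \<epsilon> (\<gamma> ` {\<tau>..})"
    then obtain t where t: "t \<ge> \<tau>" "dist y (\<gamma> t) < \<epsilon>" by (auto simp: eps_nbhd_def)
    define s where "s = sqrt t"
    have s: "s \<ge> s0" "s\<^sup>2 = t" using t(1) \<open>0 < \<tau>\<close> by (auto simp: s_def s0_def)
    show "y \<in> ball 0 r \<union> (\<Union>k\<le>N. ball (c k) ((L + 1) * \<epsilon>))"
    proof (cases "s \<le> \<epsilon> powr (- 1 / 3)")
      case True
      define k where "k = nat \<lfloor>(s - s0) / \<epsilon>\<rfloor>"
      have nn: "0 \<le> (s - s0) / \<epsilon>" using s \<epsilon> by simp
      have "real k = of_int \<lfloor>(s - s0) / \<epsilon>\<rfloor>" using nn by (simp add: k_def)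
      then have k: "real k \<le> (s - s0) / \<epsilon>" "(s - s0) / \<epsilon> < real k + 1" by linarith+
      have "(s - s0) / \<epsilon> \<le> \<epsilon> powr (- 1 / 3) / \<epsilon>"
        using True s0 \<epsilon> by (intro divide_right_mono) auto
      also have "\<dots> = \<epsilon> powr (- 1 / 3) / \<epsilon> powr 1" using \<epsilon> by simp
      also have "\<dots> = \<epsilon> powr (- 4 / 3)" unfolding powr_diff[symmetric] by simp
      finally have "real k \<le> \<epsilon> powr (- 4 / 3)" using k by simp
      then have "k \<le> N" unfolding N_def by linarith
      have "real k * \<epsilon> \<le> s - s0" "s - s0 \<le> real k * \<epsilon> + \<epsilon>"
        using k \<epsilon> by (simp_all add: field_simps)
      then have "\<bar>(s0 + real k * \<epsilon>) - s\<bar> \<le> \<epsilon>" by linarith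
      then have "L * \<bar>(s0 + real k * \<epsilon>) - s\<bar> \<le> L * \<epsilon>" using \<open>0 \<le> L\<close> by (rule mult_left_mono)
      moreover have "dist (c k) (\<gamma> t) \<le> L * \<bar>(s0 + real k * \<epsilon>) - s\<bar>"
        unfolding c_def s(2)[symmetric] using s \<epsilon> by (intro L) (auto simp: s0_def)
      ultimately have "dist (c k) y < (L + 1) * \<epsilon>"
        using t(2) dist_triangle[of "c k" y "\<gamma> t"] by (simp add: dist_commute algebra_simps)
      then show ?thesis using \<open>k \<le> N\<close> by auto
    next
      case False
      have "norm (\<gamma> t) \<le> B / s" using B[OF t(1)] by (simp add: s_def)
      also have "\<dots> \<le> B / \<epsilon> powr (- 1 / 3)"
        using False \<open>0 \<le> B\<close> s0 s \<epsilon> by (intro divide_left_mono) auto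
      also have "\<dots> = B * \<epsilon> powr (1 / 3)" by (simp add: powr_minus_divide)
      finally have "norm y < r"
        using t(2) norm_triangle_sub[of y "\<gamma> t"] by (simp add: r_def dist_norm)
      then show ?thesis by simp
    qed
  qed
  have "emeasure lebesgue (eps_nbhd \<epsilon> (\<gamma> ` {\<tau>..}))
      \<le> emeasure lebesgue (ball 0 r \<union> (\<Union>k\<le>N. ball (c k) ((L + 1) * \<epsilon>)))"
    by (intro emeasure_mono cover) auto
  also have "\<dots> \<le> emeasure lebesgue (ball 0 r :: (real \<times> real) set) + emeasure lebesgue (\<Union>k\<le>N. ball (c k) ((L + 1) * \<epsilon>))"
    by (intro emeasure_subadditive) auto
  also have "\<dots> \<le> emeasure lebesgue (ball 0 r :: (real \<times> real) set) + (\<Sum>k\<le>N. emeasure lebesgue (ball (c k) ((L + 1) * \<epsilon>)))"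
    by (intro add_left_mono emeasure_subadditive_finite) auto
  also have "\<dots> = ennreal (pi * r\<^sup>2) + (\<Sum>k\<le>N. ennreal (pi * ((L + 1) * \<epsilon>)\<^sup>2))"
    using r0 \<open>0 \<le> L\<close> \<epsilon> by (simp only: emeasure_lebesgue_disc mult_nonneg_nonneg add_nonneg_nonneg zero_le_one less_imp_le)
  also have "\<dots> = ennreal (pi * r\<^sup>2 + (\<Sum>k\<le>N. pi * ((L + 1) * \<epsilon>)\<^sup>2))"
    by (subst sum_ennreal) (auto simp: ennreal_plus sum_nonneg simp del: sum_constant)
  also have "\<dots> \<le> ennreal (pi * ((B + 1)\<^sup>2 + 3 * (L + 1)\<^sup>2) * \<epsilon> powr (2 / 3))"
  proof (rule ennreal_leI)
    have p23: "(\<epsilon> powr (1 / 3))\<^sup>2 = \<epsilon> powr (2 / 3)"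
      using \<epsilon> powr_powr[of \<epsilon> "1 / 3" 2] by simp
    have "\<epsilon> powr 1 \<le> \<epsilon> powr (1 / 3)" using \<epsilon> by (intro powr_mono') auto
    then have "r \<le> (B + 1) * \<epsilon> powr (1 / 3)" using \<epsilon> by (simp add: r_def algebra_simps)
    then have "r\<^sup>2 \<le> ((B + 1) * \<epsilon> powr (1 / 3))\<^sup>2" using r0 by (rule power_mono)
    then have 1: "r\<^sup>2 \<le> (B + 1)\<^sup>2 * \<epsilon> powr (2 / 3)" by (simp add: power_mult_distrib p23)
    have "\<epsilon> powr 0 \<le> \<epsilon> powr (- 4 / 3)" using \<epsilon> by (intro powr_mono') auto
    then have "1 \<le> \<epsilon> powr (- 4 / 3)" using \<epsilon> by simp
    then have "real (N + 1) \<le> 3 * \<epsilon> powr (- 4 / 3)" unfolding N_def by linarith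
    then have "real (N + 1) * ((L + 1) * \<epsilon>)\<^sup>2 \<le> 3 * \<epsilon> powr (- 4 / 3) * ((L + 1) * \<epsilon>)\<^sup>2"
      by (intro mult_right_mono) auto
    also have "\<dots> = 3 * (L + 1)\<^sup>2 * (\<epsilon> powr (- 4 / 3) * \<epsilon> powr 2)"
      using \<epsilon> by (simp add: power_mult_distrib)
    also have "\<epsilon> powr (- 4 / 3) * \<epsilon> powr 2 = \<epsilon> powr (2 / 3)" unfolding powr_add[symmetric] by simp
    finally have "real (N + 1) * ((L + 1) * \<epsilon>)\<^sup>2 \<le> 3 * (L + 1)\<^sup>2 * \<epsilon> powr (2 / 3)" .
    with 1 have "r\<^sup>2 + real (N + 1) * ((L + 1) * \<epsilon>)\<^sup>2
        \<le> (B + 1)\<^sup>2 * \<epsilon> powr (2 / 3) + 3 * (L + 1)\<^sup>2 * \<epsilon> powr (2 / 3)" by (rule add_mono)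
    then have "pi * (r\<^sup>2 + real (N + 1) * ((L + 1) * \<epsilon>)\<^sup>2)
        \<le> pi * ((B + 1)\<^sup>2 * \<epsilon> powr (2 / 3) + 3 * (L + 1)\<^sup>2 * \<epsilon> powr (2 / 3))"
      by (rule mult_left_mono) simp
    then show "pi * r\<^sup>2 + (\<Sum>k\<le>N. pi * ((L + 1) * \<epsilon>)\<^sup>2)
        \<le> pi * ((B + 1)\<^sup>2 + 3 * (L + 1)\<^sup>2) * \<epsilon> powr (2 / 3)"
      by (simp add: algebra_simps)
  qed
  finally show ?thesis .
qed

text \<open>
  By \<open>spiral_near_point\<close> the whole disc of radius \<open>c * \<epsilon> powr (1 / 3)\<close> lies in the
  \<open>\<epsilon>\<close>-neighbourhood as soon as \<open>c ^ 3\<close> times the constant of that lemma is at most \<open>1\<close>.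
\<close>

lemma lebesgue_spiral_nbhd_ge:
  fixes f g :: "real \<Rightarrow> real"
  assumes "0 < R" "0 < \<tau>"
    and f: "\<And>t. t \<ge> \<tau> \<Longrightarrow> \<bar>f t - R * cos (t - \<delta>) / sqrt t\<bar> \<le> C / (t * sqrt t)"
    and g: "\<And>t. t \<ge> \<tau> \<Longrightarrow> \<bar>g t + R * sin (t - \<delta>) / sqrt t\<bar> \<le> C / (t * sqrt t)"
    and lim: "((\<lambda>t. (f t, g t)) \<longlongrightarrow> 0) at_top"
  obtains c where "0 < c" "\<forall>\<^sub>F \<epsilon> in at_right 0.
    ennreal (c * \<epsilon> powr (2 / 3)) \<le> emeasure lebesgue (eps_nbhd \<epsilon> ((\<lambda>t. (f t, g t)) ` {\<tau>..}))"
proof -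
  define A where "A = (\<lambda>t. (f t, g t)) ` {\<tau>..}"
  define K where "K = 2 * (R * pi + C) / R ^ 3"
  have "0 \<le> C / (\<tau> * sqrt \<tau>)" using f[of \<tau>] by simp
  then have "0 \<le> C" using \<open>0 < \<tau>\<close> by (simp add: zero_le_divide_iff mult_le_0_iff)
  then have K: "0 \<le> K" using \<open>0 < R\<close> by (simp add: K_def)
  define c where "c = 1 / (K + 1)"
  have c: "0 < c" "c \<le> 1" "c * K \<le> 1" using K by (simp_all add: c_def field_simps)
  have cK: "c ^ 3 * K \<le> 1"
  proof -
    have "c ^ 3 \<le> c ^ 1" using c by (intro power_decreasing) auto
    then have "c ^ 3 * K \<le> c ^ 1 * K" by (rule mult_right_mono) (rule K)
    then show ?thesis using c by simp
  qed
  have "((\<lambda>\<epsilon>::real. c * \<epsilon> powr (1 / 3)) \<longlongrightarrow> c * 0) (at_right 0)"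
    by (intro tendsto_eq_intros refl tendsto_powr2[where a=0, simplified] | auto simp: eventually_at_right_less eventually_mono[OF eventually_at_right_less])+
  moreover have "c * 0 < R / sqrt \<tau>" using \<open>0 < R\<close> \<open>0 < \<tau>\<close> by simp
  ultimately have ev: "\<forall>\<^sub>F \<epsilon> in at_right 0. c * \<epsilon> powr (1 / 3) < R / sqrt \<tau>"
    by (rule order_tendstoD)
  have "\<forall>\<^sub>F \<epsilon>::real in at_right 0. 0 < \<epsilon>" by (rule eventually_at_right_less)
  with ev have "\<forall>\<^sub>F \<epsilon> in at_right 0.
    ennreal (pi * c\<^sup>2 * \<epsilon> powr (2 / 3)) \<le> emeasure lebesgue (eps_nbhd \<epsilon> A)"
  proof eventually_elim
    case (elim \<epsilon>)
    have sub: "ball 0 (c * \<epsilon> powr (1 / 3)) \<subseteq> eps_nbhd \<epsilon> A"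
    proof
      fix p :: "real \<times> real" assume "p \<in> ball 0 (c * \<epsilon> powr (1 / 3))"
      then have p: "norm p < c * \<epsilon> powr (1 / 3)" by simp
      show "p \<in> eps_nbhd \<epsilon> A"
      proof (cases "p = 0")
        case True
        have "\<forall>\<^sub>F t in at_top. dist (f t, g t) 0 < \<epsilon>" using lim elim(2) by (rule tendstoD)
        moreover have "\<forall>\<^sub>F t in at_top. t \<ge> \<tau>" by (rule eventually_ge_at_top)
        ultimately have "\<forall>\<^sub>F t in at_top. t \<ge> \<tau> \<and> dist (f t, g t) 0 < \<epsilon>" by eventually_elim simp
        then obtain t where "t \<ge> \<tau>" "dist (f t, g t) 0 < \<epsilon>"
          using eventually_happens' trivial_limit_at_top_linorder by blast
        then show ?thesis using True by (auto simp: eps_nbhd_def A_def dist_commute)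
      next
        case False
        with p elim obtain t where t: "t \<ge> \<tau>" "dist p (f t, g t) \<le> K * norm p ^ 3"
          using spiral_near_point[OF \<open>0 < R\<close> f g \<open>0 < \<tau>\<close> False] unfolding K_def by fastforce
        have "norm p ^ 3 < (c * \<epsilon> powr (1 / 3)) ^ 3"
          using p by (intro power_strict_mono) auto
        also have "\<dots> = c ^ 3 * \<epsilon>"
          using elim powr_powr[of \<epsilon> "1 / 3" 3] by (simp add: power_mult_distrib)
        finally have n3: "norm p ^ 3 < c ^ 3 * \<epsilon>" .
        have "K * norm p ^ 3 < \<epsilon>"
        proof (cases "K = 0")
          case False
          then have "K * norm p ^ 3 < K * (c ^ 3 * \<epsilon>)" using K n3 by simp
          also have "\<dots> = (c ^ 3 * K) * \<epsilon>" by simp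
          also have "\<dots> \<le> 1 * \<epsilon>" using cK elim by (intro mult_right_mono) auto
          finally show ?thesis by simp
        qed (use elim in simp)
        with t show ?thesis by (force simp: eps_nbhd_def A_def)
      qed
    qed
    have "pi * c\<^sup>2 * \<epsilon> powr (2 / 3) = pi * (c * \<epsilon> powr (1 / 3))\<^sup>2"
      using elim powr_powr[of \<epsilon> "1 / 3" 2] by (simp add: power_mult_distrib)
    then have "ennreal (pi * c\<^sup>2 * \<epsilon> powr (2 / 3)) = emeasure lebesgue (ball (0 :: real \<times> real) (c * \<epsilon> powr (1 / 3)))"
      using c by (simp only: emeasure_lebesgue_disc mult_nonneg_nonneg less_imp_le powr_ge_zero)
    also have "\<dots> \<le> emeasure lebesgue (eps_nbhd \<epsilon> A)"
      by (intro emeasure_mono sub) (simp add: open_eps_nbhd)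
    finally show ?case .
  qed
  then show thesis using c by (intro that[of "pi * c\<^sup>2"]) (auto simp: A_def)
qed

section \<open>Solutions of the Bessel equation as such spirals\<close>

text \<open>
  Both \<open>h t + M / t\<close> (nonincreasing) and \<open>h t - M / t\<close> (nondecreasing) squeeze the limit, which
  gives existence and rate of convergence at once.
\<close>

lemma limit_if_deriv_le_inverse_square:
  fixes h h' :: "real \<Rightarrow> real"
  assumes "0 < T"
    and der: "\<And>t. t \<ge> T \<Longrightarrow> (h has_real_derivative h' t) (at t)"
    and bd: "\<And>t. t \<ge> T \<Longrightarrow> \<bar>h' t\<bar> \<le> M / t\<^sup>2"
  obtains l where "\<And>t. t \<ge> T \<Longrightarrow> \<bar>h t - l\<bar> \<le> M / t"
proof -
  have dec: "h s + M / s \<le> h t + M / t" if "T \<le> t" "t \<le> s" for s t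
  proof (rule DERIV_nonpos_imp_nonincreasing[OF that(2)])
    fix r assume "t \<le> r" "r \<le> s"
    then have r: "T \<le> r" "r > 0" using that \<open>0 < T\<close> by auto
    have "((\<lambda>r. h r + M / r) has_real_derivative h' r - M / r\<^sup>2) (at r)"
      using r by (auto intro!: derivative_eq_intros der simp: power2_eq_square)
    moreover have "h' r - M / r\<^sup>2 \<le> 0" using bd[OF r(1)] by auto
    ultimately show "\<exists>y. ((\<lambda>r. h r + M / r) has_real_derivative y) (at r) \<and> y \<le> 0" by blast
  qed
  have inc: "h t - M / t \<le> h s - M / s" if "T \<le> t" "t \<le> s" for s t
  proof (rule DERIV_nonneg_imp_nondecreasing[OF that(2)])
    fix r assume "t \<le> r" "r \<le> s"
    then have r: "T \<le> r" "r > 0" using that \<open>0 < T\<close> by auto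
    have "((\<lambda>r. h r - M / r) has_real_derivative h' r + M / r\<^sup>2) (at r)"
      using r by (auto intro!: derivative_eq_intros der simp: power2_eq_square)
    moreover have "h' r + M / r\<^sup>2 \<ge> 0" using bd[OF r(1)] by auto
    ultimately show "\<exists>y. ((\<lambda>r. h r - M / r) has_real_derivative y) (at r) \<and> y \<ge> 0" by blast
  qed
  have "0 \<le> M / T\<^sup>2" using bd[of T] by force
  then have M: "M \<ge> 0" using \<open>0 < T\<close> by (simp add: zero_le_divide_iff)
  have cross: "h t - M / t \<le> h s + M / s" if "T \<le> t" "T \<le> s" for s t
  proof -
    define m where "m = max s t"
    have "h t - M / t \<le> h m - M / m" using inc that by (simp add: m_def)
    also have "\<dots> \<le> h m + M / m" using M that \<open>0 < T\<close> by (auto simp: m_def)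
    also have "\<dots> \<le> h s + M / s" using dec that by (simp add: m_def)
    finally show ?thesis .
  qed
  define l where "l = (INF t\<in>{T..}. h t + M / t)"
  have bdd: "bdd_below ((\<lambda>t. h t + M / t) ` {T..})"
    using cross[of T] by (auto intro!: bdd_belowI2[of _ "h T - M / T"])
  show thesis
  proof (rule that)
    fix t assume t: "t \<ge> T"
    have "l \<le> h t + M / t" unfolding l_def using t by (intro cINF_lower bdd) auto
    moreover have "h t - M / t \<le> l" unfolding l_def using t cross by (intro cINF_greatest) auto
    ultimately show "\<bar>h t - l\<bar> \<le> M / t" by (simp add: abs_le_iff)
  qed
qed

text \<open>
  The candidate derivative \<open>f'\<close> is an argument because it is the second coordinate of the phase curve.
\<close>

definition solves_bessel :: "real \<Rightarrow> (real \<Rightarrow> real) \<Rightarrow> (real \<Rightarrow> real) \<Rightarrow> bool" where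
  "solves_bessel \<nu> f f' \<longleftrightarrow> (\<forall>t>0. (f has_real_derivative f' t) (at t) \<and>
     (f' has_real_derivative - (f' t / t) - (1 - \<nu>\<^sup>2 / t\<^sup>2) * f t) (at t))"

text \<open>
  Let \<open>u = sqrt t * f\<close> and \<open>v = u'\<close>, so that \<open>v' = - (1 + \<kappa> / t\<^sup>2) * u\<close>. The energy \<open>u\<^sup>2 + v\<^sup>2\<close> changes
  at relative rate at most \<open>\<bar>\<kappa>\<bar> / t\<^sup>2\<close>, which is integrable, so it is bounded and stays away from
  \<open>0\<close>. In the rotating frame the coordinates \<open>a\<close>, \<open>b\<close> of \<open>(u, v)\<close> have derivatives of order \<open>1 / t\<^sup>2\<close>
  and hence converge with error \<open>O(1 / t)\<close>; the limit is nonzero by the lower bound on the energy and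
  determines amplitude and phase.
\<close>

lemma solves_bessel_asymptotics:
  assumes sol: "solves_bessel \<nu> f f'" and "0 < t0" "f t0 \<noteq> 0" "0 < T"
  obtains R \<delta> C where "R > 0"
    "\<And>t. t \<ge> T \<Longrightarrow> \<bar>f t - R * cos (t - \<delta>) / sqrt t\<bar> \<le> C / (t * sqrt t)"
    "\<And>t. t \<ge> T \<Longrightarrow> \<bar>f' t + R * sin (t - \<delta>) / sqrt t\<bar> \<le> C / (t * sqrt t)"
proof -
  define \<kappa> where "\<kappa> = 1/4 - \<nu>\<^sup>2"
  define u where "u t = sqrt t * f t" for t
  define v where "v t = sqrt t * (f' t + f t / (2 * t))" for t
  define E where "E t = (u t)\<^sup>2 + (v t)\<^sup>2" for t
  have du: "(u has_real_derivative v t) (at t)" if "t > 0" for t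
  proof -
    have f: "(f has_real_derivative f' t) (at t)" using sol that by (auto simp: solves_bessel_def)
    have s: "inverse (sqrt t) = sqrt t / t" using that
      by (simp add: field_simps)
    show ?thesis unfolding u_def[abs_def] v_def using that
      by (auto intro!: derivative_eq_intros f simp: s) (simp add: field_simps)
  qed
  have dv: "(v has_real_derivative - (1 + \<kappa> / t\<^sup>2) * u t) (at t)" if "t > 0" for t
  proof -
    have f: "(f has_real_derivative f' t) (at t)"
      "(f' has_real_derivative - (f' t / t) - (1 - \<nu>\<^sup>2 / t\<^sup>2) * f t) (at t)"
      using sol that by (auto simp: solves_bessel_def)
    have s: "inverse (sqrt t) = sqrt t / t" using that
      by (simp add: field_simps)
    show ?thesis unfolding u_def v_def[abs_def] \<kappa>_def using that
      by (auto intro!: derivative_eq_intros f simp: s) (simp add: field_simps power2_eq_square)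
  qed
  have dE: "(E has_real_derivative - 2 * \<kappa> * u t * v t / t\<^sup>2) (at t)" if "t > 0" for t
    unfolding E_def[abs_def] using that
    by (auto intro!: derivative_eq_intros du dv) (simp add: field_simps power2_eq_square)
  have E0: "0 \<le> E t" for t by (simp add: E_def)
  have dEb: "\<bar>- 2 * \<kappa> * u t * v t / t\<^sup>2\<bar> \<le> \<bar>\<kappa>\<bar> * E t / t\<^sup>2" if "t > 0" for t
  proof -
    have "2 * \<bar>u t * v t\<bar> \<le> E t" unfolding E_def abs_mult
      using sum_squares_bound[of "\<bar>u t\<bar>" "\<bar>v t\<bar>"] by simp
    then have "\<bar>\<kappa>\<bar> * (2 * \<bar>u t * v t\<bar>) \<le> \<bar>\<kappa>\<bar> * E t" by (intro mult_left_mono) auto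
    then show ?thesis using that by (simp add: abs_mult divide_right_mono mult.assoc mult.left_commute)
  qed
  \<comment> \<open>Gronwall: the factor \<open>exp (\<bar>\<kappa>\<bar> / t)\<close> has logarithmic derivative \<open>- \<bar>\<kappa>\<bar> / t\<^sup>2\<close>\<close>
  have Edec: "E s * exp (\<bar>\<kappa>\<bar> / s) \<le> E t * exp (\<bar>\<kappa>\<bar> / t)" if "0 < t" "t \<le> s" for s t
  proof (rule DERIV_nonpos_imp_nonincreasing[OF that(2)])
    fix r assume "t \<le> r" "r \<le> s"
    then have r: "r > 0" using that by auto
    have "((\<lambda>r. E r * exp (\<bar>\<kappa>\<bar> / r)) has_real_derivative
        (- 2 * \<kappa> * u r * v r / r\<^sup>2 - \<bar>\<kappa>\<bar> * E r / r\<^sup>2) * exp (\<bar>\<kappa>\<bar> / r)) (at r)"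
      using r by (auto intro!: derivative_eq_intros dE) (simp add: field_simps power2_eq_square)
    moreover have "(- 2 * \<kappa> * u r * v r / r\<^sup>2 - \<bar>\<kappa>\<bar> * E r / r\<^sup>2) * exp (\<bar>\<kappa>\<bar> / r) \<le> 0"
      using dEb[OF r, unfolded abs_le_iff] by (intro mult_nonpos_nonneg) auto
    ultimately show "\<exists>y. ((\<lambda>r. E r * exp (\<bar>\<kappa>\<bar> / r)) has_real_derivative y) (at r) \<and> y \<le> 0" by blast
  qed
  have Einc: "E t * exp (- \<bar>\<kappa>\<bar> / t) \<le> E s * exp (- \<bar>\<kappa>\<bar> / s)" if "0 < t" "t \<le> s" for s t
  proof (rule DERIV_nonneg_imp_nondecreasing[OF that(2)])
    fix r assume "t \<le> r" "r \<le> s"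
    then have r: "r > 0" using that by auto
    have "((\<lambda>r. E r * exp (- \<bar>\<kappa>\<bar> / r)) has_real_derivative
        (- 2 * \<kappa> * u r * v r / r\<^sup>2 + \<bar>\<kappa>\<bar> * E r / r\<^sup>2) * exp (- \<bar>\<kappa>\<bar> / r)) (at r)"
      using r by (auto intro!: derivative_eq_intros dE) (simp add: field_simps power2_eq_square)
    moreover have "(- 2 * \<kappa> * u r * v r / r\<^sup>2 + \<bar>\<kappa>\<bar> * E r / r\<^sup>2) * exp (- \<bar>\<kappa>\<bar> / r) \<ge> 0"
      using dEb[OF r, unfolded abs_le_iff] by (intro mult_nonneg_nonneg) (simp_all, linarith?)
    ultimately show "\<exists>y. ((\<lambda>r. E r * exp (- \<bar>\<kappa>\<bar> / r)) has_real_derivative y) (at r) \<and> y \<ge> 0" by blast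
  qed
  define M where "M = E T * exp (\<bar>\<kappa>\<bar> / T)"
  have EM: "E t \<le> M" if "t \<ge> T" for t
  proof -
    have "E t * 1 \<le> E t * exp (\<bar>\<kappa>\<bar> / t)"
      using that \<open>0 < T\<close> by (intro mult_left_mono E0) auto
    then show ?thesis using Edec[of T t] that \<open>0 < T\<close> by (simp add: M_def)
  qed
  define m where "m = E t0 * exp (- \<bar>\<kappa>\<bar> / t0)"
  have "u t0 \<noteq> 0" using \<open>0 < t0\<close> \<open>f t0 \<noteq> 0\<close> by (simp add: u_def)
  then have "0 < m" by (simp add: m_def E_def add_pos_nonneg)
  have mE: "m \<le> E t" if "t \<ge> t0" for t
  proof -
    have "m \<le> E t * exp (- \<bar>\<kappa>\<bar> / t)" using Einc[of t0 t] that \<open>0 < t0\<close> by (simp add: m_def)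
    also have "\<dots> \<le> E t * 1" using that \<open>0 < t0\<close> by (intro mult_left_mono E0) auto
    finally show ?thesis by simp
  qed
  \<comment> \<open>variation of constants for the unperturbed oscillator\<close>
  define a where "a t = u t * cos t - v t * sin t" for t
  define b where "b t = u t * sin t + v t * cos t" for t
  have u_eq: "u t = a t * cos t + b t * sin t" and v_eq: "v t = b t * cos t - a t * sin t" for t
    using sin_cos_squared_add[of t] unfolding a_def b_def by algebra+
  have ab: "(a t)\<^sup>2 + (b t)\<^sup>2 = E t" for t
    using sin_cos_squared_add[of t] unfolding a_def b_def E_def by algebra
  have da: "(a has_real_derivative \<kappa> * u t * sin t / t\<^sup>2) (at t)" if "t > 0" for t
    unfolding a_def[abs_def] using that
    by (auto intro!: derivative_eq_intros du dv) (simp add: field_simps power2_eq_square)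
  have db: "(b has_real_derivative - \<kappa> * u t * cos t / t\<^sup>2) (at t)" if "t > 0" for t
    unfolding b_def[abs_def] using that
    by (auto intro!: derivative_eq_intros du dv) (simp add: field_simps power2_eq_square)
  define K where "K = \<bar>\<kappa>\<bar> * sqrt M"
  have uM: "\<bar>u t\<bar> \<le> sqrt M" if "t \<ge> T" for t
  proof -
    have "(u t)\<^sup>2 \<le> E t" by (simp add: E_def)
    then have "sqrt ((u t)\<^sup>2) \<le> sqrt M" using EM[OF that] by (intro real_sqrt_le_mono) linarith
    then show ?thesis by simp
  qed
  have bd: "\<bar>\<kappa> * u t * x / t\<^sup>2\<bar> \<le> K / t\<^sup>2" if "t \<ge> T" "\<bar>x\<bar> \<le> 1" for t x
  proof -
    have "\<bar>\<kappa>\<bar> * \<bar>u t\<bar> * \<bar>x\<bar> \<le> \<bar>\<kappa>\<bar> * sqrt M * 1"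
      using that uM[OF that(1)] by (intro mult_mono) (auto intro: mult_nonneg_nonneg order.trans[OF abs_ge_zero])
    then show ?thesis by (simp add: K_def abs_mult divide_right_mono)
  qed
  have pos: "t > 0" if "t \<ge> T" for t using that \<open>0 < T\<close> by simp
  obtain A where A: "\<And>t. t \<ge> T \<Longrightarrow> \<bar>a t - A\<bar> \<le> K / t"
    using limit_if_deriv_le_inverse_square[OF \<open>0 < T\<close> da[OF pos] bd[OF _ abs_sin_le_one]] by metis
  have bd': "\<bar>- \<kappa> * u t * cos t / t\<^sup>2\<bar> \<le> K / t\<^sup>2" if "t \<ge> T" for t
    using bd[OF that abs_cos_le_one[of t]] by simp
  obtain B where B: "\<And>t. t \<ge> T \<Longrightarrow> \<bar>b t - B\<bar> \<le> K / t"
    using limit_if_deriv_le_inverse_square[OF \<open>0 < T\<close> db[OF pos] bd'] by metis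
  have lim0: "((\<lambda>t. K / t) \<longlongrightarrow> 0) at_top"
    by (rule real_tendsto_divide_at_top[OF tendsto_const filterlim_ident])
  have evT: "\<forall>\<^sub>F t in at_top. norm (g t) \<le> K / t" if "\<And>t. t \<ge> T \<Longrightarrow> \<bar>g t\<bar> \<le> K / t" for g :: "real \<Rightarrow> real"
    using that by (auto simp: eventually_at_top_linorder)
  have "(a \<longlongrightarrow> A) at_top" "(b \<longlongrightarrow> B) at_top"
    by (auto intro!: Lim_null[THEN iffD2] Lim_null_comparison[OF _ lim0] evT A B)
  then have "((\<lambda>t. (a t)\<^sup>2 + (b t)\<^sup>2) \<longlongrightarrow> A\<^sup>2 + B\<^sup>2) at_top" by (intro tendsto_intros)
  then have "(E \<longlongrightarrow> A\<^sup>2 + B\<^sup>2) at_top" unfolding ab .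
  then have "m \<le> A\<^sup>2 + B\<^sup>2"
    by (rule tendsto_lowerbound) (auto simp: eventually_at_top_linorder intro!: mE exI[of _ t0])
  then have AB: "A\<^sup>2 + B\<^sup>2 > 0" using \<open>0 < m\<close> by simp
  define R where "R = sqrt (A\<^sup>2 + B\<^sup>2)"
  have "R > 0" using AB by (simp add: R_def)
  have "(A / R)\<^sup>2 + (B / R)\<^sup>2 = 1"
    using AB by (auto simp: R_def power_divide simp flip: add_divide_distrib)
  then obtain \<delta> where \<delta>: "A / R = cos \<delta>" "B / R = sin \<delta>" by (metis sincos_total_2pi)
  then have A_eq: "A = R * cos \<delta>" and B_eq: "B = R * sin \<delta>" using \<open>R > 0\<close> by (auto simp: field_simps)
  have comb: "\<bar>x * p + y * q\<bar> \<le> 2 * K / t" if "\<bar>x\<bar> \<le> K / t" "\<bar>y\<bar> \<le> K / t" "\<bar>p\<bar> \<le> 1" "\<bar>q\<bar> \<le> 1" for x y p q t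
  proof -
    have "\<bar>x * p\<bar> \<le> K / t * 1" "\<bar>y * q\<bar> \<le> K / t * 1"
      unfolding abs_mult using that by (intro mult_mono; force)+
    then have "\<bar>x * p + y * q\<bar> \<le> K / t + K / t" by linarith
    then show ?thesis by simp
  qed
  show thesis
  proof (rule that[OF \<open>R > 0\<close>])
    fix t assume t: "T \<le> t"
    then have t0: "t > 0" using \<open>0 < T\<close> by simp
    have Mn: "0 \<le> sqrt M" using uM[OF t] by linarith
    have "\<bar>(a t - A) * cos t + (b t - B) * sin t\<bar> \<le> 2 * K / t"
      using A[OF t] B[OF t] by (intro comb) auto
    moreover have "u t - R * cos (t - \<delta>) = (a t - A) * cos t + (b t - B) * sin t"
      unfolding u_eq A_eq B_eq cos_diff by (simp add: algebra_simps)
    ultimately have 1: "\<bar>u t - R * cos (t - \<delta>)\<bar> \<le> 2 * K / t" by simp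
    have "\<bar>(b t - B) * cos t + (a t - A) * (- sin t)\<bar> \<le> 2 * K / t"
      using A[OF t] B[OF t] by (intro comb) auto
    moreover have "v t + R * sin (t - \<delta>) = (b t - B) * cos t + (a t - A) * (- sin t)"
      unfolding v_eq A_eq B_eq sin_diff by (simp add: algebra_simps)
    ultimately have 2: "\<bar>v t + R * sin (t - \<delta>)\<bar> \<le> 2 * K / t" by simp
    have "\<bar>f t - R * cos (t - \<delta>) / sqrt t\<bar> = \<bar>(u t - R * cos (t - \<delta>)) / sqrt t\<bar>"
      using t0 by (simp add: u_def diff_divide_distrib)
    also have "\<dots> = \<bar>u t - R * cos (t - \<delta>)\<bar> / sqrt t" using t0 by simp
    also have "\<dots> \<le> (2 * K / t) / sqrt t" using 1 by (intro divide_right_mono) (use t0 in auto)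
    also have "\<dots> \<le> (2 * K + sqrt M) / (t * sqrt t)" using t0 Mn by (simp add: divide_right_mono)
    finally show "\<bar>f t - R * cos (t - \<delta>) / sqrt t\<bar> \<le> (2 * K + sqrt M) / (t * sqrt t)" .
    have "\<bar>f' t + R * sin (t - \<delta>) / sqrt t\<bar> = \<bar>((v t + R * sin (t - \<delta>)) - u t / (2 * t)) / sqrt t\<bar>"
      using t0 by (simp add: u_def v_def diff_divide_distrib add_divide_distrib)
    also have "\<dots> = \<bar>(v t + R * sin (t - \<delta>)) - u t / (2 * t)\<bar> / sqrt t" using t0 by simp
    also have "\<dots> \<le> (2 * K / t + sqrt M / t) / sqrt t"
    proof (intro divide_right_mono)
      have "\<bar>u t / (2 * t)\<bar> \<le> sqrt M / t"
        using uM[OF t] Mn t0 by (simp add: field_simps)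
      then show "\<bar>(v t + R * sin (t - \<delta>)) - u t / (2 * t)\<bar> \<le> 2 * K / t + sqrt M / t"
        using 2 by linarith
    qed (use t0 in auto)
    also have "\<dots> = (2 * K + sqrt M) / (t * sqrt t)" by (simp add: add_divide_distrib)
    finally show "\<bar>f' t + R * sin (t - \<delta>) / sqrt t\<bar> \<le> (2 * K + sqrt M) / (t * sqrt t)" .
  qed
qed

text \<open>
  The asymptotics give the decay \<open>norm (f t, f' t) = O(1 / sqrt t)\<close>, and the differential equation
  carries it over to \<open>f''\<close>. Hence in the parameter \<open>s = sqrt t\<close> the curve is Lipschitz, as the area
  bounds for spirals require.
\<close>

lemma solves_bessel_box_dim:
  assumes sol: "solves_bessel \<nu> f f'" and "0 < t0" "f t0 \<noteq> 0" "0 < \<tau>"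
  shows "has_box_dim ((\<lambda>t. (f t, f' t)) ` {\<tau>..}) (4 / 3)"
proof -
  from solves_bessel_asymptotics[OF assms] obtain R \<delta> C where R: "R > 0"
    and f: "\<And>t. t \<ge> \<tau> \<Longrightarrow> \<bar>f t - R * cos (t - \<delta>) / sqrt t\<bar> \<le> C / (t * sqrt t)"
    and f': "\<And>t. t \<ge> \<tau> \<Longrightarrow> \<bar>f' t + R * sin (t - \<delta>) / sqrt t\<bar> \<le> C / (t * sqrt t)"
    by blast
  have "0 \<le> C / (\<tau> * sqrt \<tau>)" using f[of \<tau>] by simp
  then have C: "0 \<le> C" using \<open>0 < \<tau>\<close> by (simp add: zero_le_divide_iff mult_le_0_iff)
  define B where "B = R + C / \<tau>"
  have B: "B \<ge> 0" using R C \<open>0 < \<tau>\<close> by (simp add: B_def)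
  have decay: "\<bar>y\<bar> \<le> B / sqrt t"
    if "t \<ge> \<tau>" "\<bar>y - R * x / sqrt t\<bar> \<le> C / (t * sqrt t)" "\<bar>x\<bar> \<le> 1" for x y t
  proof -
    have t: "t > 0" using that \<open>0 < \<tau>\<close> by simp
    have "\<bar>R * x / sqrt t\<bar> \<le> R / sqrt t"
      using t R mult_left_mono[OF that(3), of R] by (simp add: abs_mult divide_right_mono)
    moreover have "C / (t * sqrt t) \<le> C / \<tau> / sqrt t"
      using t that C \<open>0 < \<tau>\<close> by (auto simp: divide_right_mono divide_left_mono simp flip: divide_divide_eq_left)
    moreover have "B / sqrt t = R / sqrt t + C / \<tau> / sqrt t" by (simp add: B_def add_divide_distrib)
    ultimately show ?thesis using that(2) by linarith
  qed
  have fB: "\<bar>f t\<bar> \<le> B / sqrt t" if "t \<ge> \<tau>" for t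
    using f[OF that] by (intro decay[OF that, of _ "cos (t - \<delta>)"]) auto
  have f'B: "\<bar>f' t\<bar> \<le> B / sqrt t" if "t \<ge> \<tau>" for t
    using f'[OF that] by (intro decay[OF that, of _ "- sin (t - \<delta>)"]) auto
  have norm_le: "norm (f t, f' t) \<le> 2 * B / sqrt t" if "t \<ge> \<tau>" for t
    using norm_Pair_le_sum[of "f t" "f' t"] fB[OF that] f'B[OF that] by simp
  have lim: "((\<lambda>t. (f t, f' t)) \<longlongrightarrow> 0) at_top"
  proof (rule Lim_null_comparison)
    show "\<forall>\<^sub>F t in at_top. norm (f t, f' t) \<le> 2 * B / sqrt t"
      using norm_le by (auto simp: eventually_at_top_linorder)
    show "((\<lambda>t. 2 * B / sqrt t) \<longlongrightarrow> 0) at_top"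
      by (rule real_tendsto_divide_at_top[OF tendsto_const sqrt_at_top])
  qed
  define L where "L = B * (1 / \<tau> + 1 + \<nu>\<^sup>2 / \<tau>\<^sup>2)"
  have L: "0 \<le> L" using B \<open>0 < \<tau>\<close> by (simp add: L_def)
  have lip: "dist (f (s\<^sup>2), f' (s\<^sup>2)) (f (r\<^sup>2), f' (r\<^sup>2)) \<le> (2 * B + 2 * L) * \<bar>s - r\<bar>"
    if "s \<ge> sqrt \<tau>" "r \<ge> sqrt \<tau>" for s r
  proof -
    have sq: "x > 0" "x\<^sup>2 \<ge> \<tau>" "sqrt (x\<^sup>2) = x" if "x \<in> {sqrt \<tau>..}" for x
    proof -
      show "x > 0" using that \<open>0 < \<tau>\<close> less_le_trans[of 0 "sqrt \<tau>" x] by simp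
      then show "sqrt (x\<^sup>2) = x" by simp
      show "x\<^sup>2 \<ge> \<tau>" using that by (simp add: sqrt_le_D)
    qed
    have scale: "\<bar>2 * x * y\<bar> \<le> 2 * K" if "x > 0" "\<bar>y\<bar> \<le> K / x" for x y K :: real
      using that by (simp add: abs_mult field_simps)
    have "norm (f (s\<^sup>2) - f (r\<^sup>2)) \<le> 2 * B * norm (s - r)"
    proof (rule field_differentiable_bound[of "{sqrt \<tau>..}" _ "\<lambda>x. 2 * x * f' (x\<^sup>2)"])
      fix x assume x: "x \<in> {sqrt \<tau>..}"
      have "(f has_real_derivative f' (x\<^sup>2)) (at (x\<^sup>2))" using sol sq(1)[OF x] by (auto simp: solves_bessel_def)
      then have "((\<lambda>x. f (x\<^sup>2)) has_real_derivative f' (x\<^sup>2) * (2 * x)) (at x within {sqrt \<tau>..})"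
        by (rule DERIV_chain2[where f=f]) (auto intro!: derivative_eq_intros)
      then show "((\<lambda>x. f (x\<^sup>2)) has_real_derivative 2 * x * f' (x\<^sup>2)) (at x within {sqrt \<tau>..})"
        by (simp only: mult.commute)
      show "norm (2 * x * f' (x\<^sup>2)) \<le> 2 * B"
        using scale[OF sq(1)[OF x], of "f' (x\<^sup>2)" B] f'B[OF sq(2)[OF x]] sq[OF x] by simp
    qed (use that in auto)
    moreover have "norm (f' (s\<^sup>2) - f' (r\<^sup>2)) \<le> 2 * L * norm (s - r)"
    proof (rule field_differentiable_bound[of "{sqrt \<tau>..}" _
          "\<lambda>x. 2 * x * (- (f' (x\<^sup>2) / x\<^sup>2) - (1 - \<nu>\<^sup>2 / (x\<^sup>2)\<^sup>2) * f (x\<^sup>2))"])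
      fix x assume x: "x \<in> {sqrt \<tau>..}"
      define t where "t = x\<^sup>2"
      have t: "t > 0" "t \<ge> \<tau>" "sqrt t = x" using sq[OF x] by (auto simp: t_def)
      have "(f' has_real_derivative - (f' t / t) - (1 - \<nu>\<^sup>2 / t\<^sup>2) * f t) (at t)"
        using sol t by (auto simp: solves_bessel_def)
      then have "((\<lambda>x. f' (x\<^sup>2)) has_real_derivative
          (- (f' t / t) - (1 - \<nu>\<^sup>2 / t\<^sup>2) * f t) * (2 * x)) (at x within {sqrt \<tau>..})"
        unfolding t_def
        by (rule DERIV_chain2[where f=f']) (auto intro!: derivative_eq_intros)
      then show "((\<lambda>x. f' (x\<^sup>2)) has_real_derivative
          2 * x * (- (f' (x\<^sup>2) / x\<^sup>2) - (1 - \<nu>\<^sup>2 / (x\<^sup>2)\<^sup>2) * f (x\<^sup>2))) (at x within {sqrt \<tau>..})"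
        unfolding t_def by (simp only: mult.commute)
      have "\<bar>f' t / t\<bar> \<le> B / sqrt t * (1 / \<tau>)"
        using f'B[OF t(2)] t \<open>0 < \<tau>\<close> B
        by (simp only: abs_divide divide_inverse[of "\<bar>f' t\<bar>"] divide_inverse[of 1])
           (intro mult_mono; simp add: le_imp_inverse_le)
      moreover have "\<bar>(1 - \<nu>\<^sup>2 / t\<^sup>2) * f t\<bar> \<le> (1 + \<nu>\<^sup>2 / \<tau>\<^sup>2) * (B / sqrt t)"
      proof -
        have "\<nu>\<^sup>2 / t\<^sup>2 \<le> \<nu>\<^sup>2 / \<tau>\<^sup>2"
          using t \<open>0 < \<tau>\<close> by (intro divide_left_mono power_mono) auto
        moreover have "0 \<le> \<nu>\<^sup>2 / t\<^sup>2" by simp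
        ultimately have "\<bar>1 - \<nu>\<^sup>2 / t\<^sup>2\<bar> \<le> 1 + \<nu>\<^sup>2 / \<tau>\<^sup>2" by linarith
        then show ?thesis unfolding abs_mult using fB[OF t(2)] by (intro mult_mono) auto
      qed
      moreover have "B / sqrt t * (1 / \<tau>) + (1 + \<nu>\<^sup>2 / \<tau>\<^sup>2) * (B / sqrt t) = L / x"
        unfolding L_def t(3)[symmetric] by (simp add: algebra_simps add_divide_distrib)
      ultimately have "\<bar>- (f' t / t) - (1 - \<nu>\<^sup>2 / t\<^sup>2) * f t\<bar> \<le> L / x" by linarith
      from scale[OF sq(1)[OF x] this]
      show "norm (2 * x * (- (f' (x\<^sup>2) / x\<^sup>2) - (1 - \<nu>\<^sup>2 / (x\<^sup>2)\<^sup>2) * f (x\<^sup>2))) \<le> 2 * L"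
        by (simp add: t_def)
    qed (use that in auto)
    moreover have "dist (f (s\<^sup>2), f' (s\<^sup>2)) (f (r\<^sup>2), f' (r\<^sup>2)) \<le> \<bar>f (s\<^sup>2) - f (r\<^sup>2)\<bar> + \<bar>f' (s\<^sup>2) - f' (r\<^sup>2)\<bar>"
      unfolding dist_norm by (simp add: norm_Pair_le_sum)
    ultimately show ?thesis by (simp add: algebra_simps)
  qed
  obtain c where c: "0 < c" "\<forall>\<^sub>F \<epsilon> in at_right 0. ennreal (c * \<epsilon> powr (2 / 3))
      \<le> emeasure lebesgue (eps_nbhd \<epsilon> ((\<lambda>t. (f t, f' t)) ` {\<tau>..}))"
    using lebesgue_spiral_nbhd_ge[OF R \<open>0 < \<tau>\<close> f f' lim] by blast
  have exponent: "real DIM(real \<times> real) - 4 / 3 = 2 / 3" by simp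
  show ?thesis
  proof (rule has_box_dimI[where 'a = "real \<times> real" and d = "4 / 3", unfolded exponent, OF _ c(1)])
    have "norm (f t, f' t) \<le> 2 * B / sqrt \<tau>" if "t \<ge> \<tau>" for t
      using norm_le[OF that] B that \<open>0 < \<tau>\<close> divide_left_mono[of "sqrt \<tau>" "sqrt t" "2 * B"] by force
    then show "bounded ((\<lambda>t. (f t, f' t)) ` {\<tau>..})" unfolding bounded_iff by blast
    show "\<forall>\<^sub>F \<epsilon> in at_right 0. emeasure lebesgue (eps_nbhd \<epsilon> ((\<lambda>t. (f t, f' t)) ` {\<tau>..}))
      \<le> ennreal (pi * ((2 * B + 1)\<^sup>2 + 3 * (2 * B + 2 * L + 1)\<^sup>2) * \<epsilon> powr (2 / 3))"
      unfolding eventually_at_right_field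
    proof (intro exI[of _ 1] conjI allI impI)
      fix \<epsilon> :: real assume "0 < \<epsilon>" "\<epsilon> < 1"
      then show "emeasure lebesgue (eps_nbhd \<epsilon> ((\<lambda>t. (f t, f' t)) ` {\<tau>..}))
        \<le> ennreal (pi * ((2 * B + 1)\<^sup>2 + 3 * (2 * B + 2 * L + 1)\<^sup>2) * \<epsilon> powr (2 / 3))"
        using B L by (intro lebesgue_curve_nbhd_le norm_le lip \<open>0 < \<tau>\<close>) auto
    qed simp
  qed (use c in auto)
qed

lemma solves_bessel_phase_dim:
  assumes sol: "solves_bessel \<nu> f f'" and "0 < t0" "f t0 \<noteq> 0" "0 < \<tau>"
    and x: "\<forall>t\<ge>\<tau>. x t = f t"
  shows "has_phase_dim \<tau> x (4 / 3)"
proof -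
  have f: "(f has_real_derivative f' t) (at t)" and f': "isCont f' t" if "t \<ge> \<tau>" for t
  proof -
    have "t > 0" using that \<open>0 < \<tau>\<close> by simp
    then show "(f has_real_derivative f' t) (at t)" "isCont f' t"
      using sol unfolding solves_bessel_def by (blast intro: DERIV_isCont)+
  qed
  have der: "(x has_real_derivative f' t) (at t within {\<tau>..})" if "t \<ge> \<tau>" for t
    using has_field_derivative_at_within[OF f[OF that]]
    by (rule has_field_derivative_transform_within[where d=1]) (use x that in auto)
  have vd: "vector_derivative x (at t within {\<tau>..}) = f' t" if "t \<ge> \<tau>" for t
  proof (rule vector_derivative_within)
    have "at_right t \<le> at t within {\<tau>..}" using that by (intro at_le) auto
    then show "at t within {\<tau>..} \<noteq> bot" using trivial_limit_at_right_real[of t] by (metis bot.extremum_uniqueI)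
    show "(x has_vector_derivative f' t) (at t within {\<tau>..})"
      using der[OF that] by (simp add: has_real_derivative_iff_has_vector_derivative)
  qed
  have "C1_on_ray \<tau> x"
    unfolding C1_on_ray_def
  proof
    show "x differentiable_on {\<tau>..}"
      unfolding differentiable_on_def
      using der by (auto intro: has_field_derivative_imp_has_derivative differentiableI)
    have "continuous_on {\<tau>..} f'" using f' by (auto intro: continuous_at_imp_continuous_on)
    then show "continuous_on {\<tau>..} (\<lambda>t. vector_derivative x (at t within {\<tau>..}))"
      by (rule continuous_on_eq) (simp add: vd)
  qed
  moreover have "phase_curve \<tau> x = (\<lambda>t. (f t, f' t)) ` {\<tau>..}"
    unfolding phase_curve_def using x by (intro image_cong) (auto simp: vd)
  ultimately show ?thesis
    unfolding has_phase_dim_def using solves_bessel_box_dim[OF assms(1-4)] by simp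
qed

section \<open>Frobenius series and their derivatives in the order\<close>

text \<open>
  The inhomogeneous Bessel equation \<open>t\<^sup>2 * f'' + t * f' + (t\<^sup>2 - \<nu>\<^sup>2) * f = t\<^sup>2 * r\<close>, divided by \<open>t\<^sup>2\<close>.
\<close>

definition forced_bessel :: "real \<Rightarrow> (real \<Rightarrow> real) \<Rightarrow> (real \<Rightarrow> real) \<Rightarrow> (real \<Rightarrow> real) \<Rightarrow> bool" where
  "forced_bessel \<nu> r f f' \<longleftrightarrow> (\<forall>t>0. (f has_real_derivative f' t) (at t) \<and>
     (f' has_real_derivative - (f' t / t) - (1 - \<nu>\<^sup>2 / t\<^sup>2) * f t + r t) (at t))"

text \<open>
  The Frobenius ansatz at the regular singular point \<open>0\<close>. The logarithm produces the derivative of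
  \<open>(t / 2) powr \<nu>\<close> with respect to \<open>\<nu>\<close>.
\<close>

definition frobenius :: "real \<Rightarrow> (real \<Rightarrow> real) \<Rightarrow> (real \<Rightarrow> real) \<Rightarrow> real \<Rightarrow> real" where
  "frobenius \<nu> P Q t = (t / 2) powr \<nu> * (ln (t / 2) * P ((t / 2)\<^sup>2) + Q ((t / 2)\<^sup>2))"

text \<open>
  The operator \<open>t * d/dt\<close> maps the class of Frobenius functions with exponent \<open>\<nu>\<close> to itself, which
  makes the second derivative a second application of the same rule.
\<close>

lemma frobenius_deriv:
  assumes P: "\<And>z. (P has_real_derivative P' z) (at z)"
    and Q: "\<And>z. (Q has_real_derivative Q' z) (at z)" and "0 < t"
  shows "(frobenius \<nu> P Q has_real_derivative
    frobenius \<nu> (\<lambda>z. \<nu> * P z + 2 * z * P' z) (\<lambda>z. \<nu> * Q z + P z + 2 * z * Q' z) t / t) (at t)"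
proof -
  have sq: "((\<lambda>t. (t / 2)\<^sup>2) has_real_derivative t / 2) (at t)"
    by (auto intro!: derivative_eq_intros)
  have P2: "((\<lambda>t. P ((t / 2)\<^sup>2)) has_real_derivative P' ((t / 2)\<^sup>2) * (t / 2)) (at t)"
    by (rule DERIV_chain2[OF P sq])
  have Q2: "((\<lambda>t. Q ((t / 2)\<^sup>2)) has_real_derivative Q' ((t / 2)\<^sup>2) * (t / 2)) (at t)"
    by (rule DERIV_chain2[OF Q sq])
  have pw: "((\<lambda>t. (t / 2) powr \<nu>) has_real_derivative \<nu> * (t / 2) powr \<nu> / t) (at t)"
    using \<open>0 < t\<close> by (auto intro!: derivative_eq_intros simp: powr_diff field_simps)
  have lg: "((\<lambda>t. ln (t / 2)) has_real_derivative 1 / t) (at t)"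
    using \<open>0 < t\<close> by (auto intro!: derivative_eq_intros simp: field_simps)
  show ?thesis
    unfolding frobenius_def[abs_def]
    by (rule DERIV_cong[OF DERIV_mult[OF pw DERIV_add[OF DERIV_mult[OF lg P2] Q2]]])
       (use \<open>0 < t\<close> in \<open>simp add: field_simps power2_eq_square\<close>)
qed

text \<open>
  With \<open>z = (t / 2)\<^sup>2\<close>, the Bessel operator acts on \<open>P\<close> as \<open>4 * z * (z * P'' + (\<nu> + 1) * P' + P)\<close>.
  The logarithm contributes \<open>4 * z * P' + 2 * \<nu> * P\<close> to the part without logarithm; the first term is
  absorbed by the equation for \<open>Q\<close>, the second is the forcing.
\<close>

lemma frobenius_forced_bessel:
  assumes P: "\<And>z. (P has_real_derivative P' z) (at z)" "\<And>z. (P' has_real_derivative P'' z) (at z)"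
    and Q: "\<And>z. (Q has_real_derivative Q' z) (at z)" "\<And>z. (Q' has_real_derivative Q'' z) (at z)"
    and eqP: "\<And>z. z * P'' z + (\<nu> + 1) * P' z + P z = 0"
    and eqQ: "\<And>z. z * Q'' z + (\<nu> + 1) * Q' z + Q z + P' z = 0"
  shows "\<exists>y'. forced_bessel \<nu> (\<lambda>t. 2 * \<nu> / t\<^sup>2 * ((t / 2) powr \<nu> * P ((t / 2)\<^sup>2))) (frobenius \<nu> P Q) y'"
proof -
  define P1 where "P1 z = \<nu> * P z + 2 * z * P' z" for z
  define Q1 where "Q1 z = \<nu> * Q z + P z + 2 * z * Q' z" for z
  define P1' where "P1' z = \<nu> * P' z + 2 * P' z + 2 * z * P'' z" for z
  define Q1' where "Q1' z = \<nu> * Q' z + P' z + 2 * Q' z + 2 * z * Q'' z" for z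
  have P1: "(P1 has_real_derivative P1' z) (at z)" for z
    unfolding P1_def[abs_def] P1'_def by (auto intro!: derivative_eq_intros P)
  have Q1: "(Q1 has_real_derivative Q1' z) (at z)" for z
    unfolding Q1_def[abs_def] Q1'_def by (auto intro!: derivative_eq_intros P Q)
  have P2: "\<nu> * P1 z + 2 * z * P1' z = (\<nu>\<^sup>2 - 4 * z) * P z" for z
    using eqP[of z] unfolding P1_def P1'_def by algebra
  have Q2: "\<nu> * Q1 z + P1 z + 2 * z * Q1' z = (\<nu>\<^sup>2 - 4 * z) * Q z + 2 * \<nu> * P z" for z
    using eqQ[of z] unfolding P1_def Q1_def Q1'_def by algebra
  show ?thesis
    unfolding forced_bessel_def
  proof (intro exI[of _ "\<lambda>t. frobenius \<nu> P1 Q1 t / t"] allI impI conjI)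
    fix t :: real assume t: "t > 0"
    show "(frobenius \<nu> P Q has_real_derivative frobenius \<nu> P1 Q1 t / t) (at t)"
      using frobenius_deriv[OF P(1) Q(1) t, of \<nu>] by (simp add: P1_def[abs_def] Q1_def[abs_def])
    have "frobenius \<nu> (\<lambda>z. \<nu> * P1 z + 2 * z * P1' z) (\<lambda>z. \<nu> * Q1 z + P1 z + 2 * z * Q1' z) t
        = (\<nu>\<^sup>2 - t\<^sup>2) * frobenius \<nu> P Q t + 2 * \<nu> * ((t / 2) powr \<nu> * P ((t / 2)\<^sup>2))"
      unfolding P2 Q2 frobenius_def by (simp add: algebra_simps power_divide)
    with frobenius_deriv[OF P1 Q1 t, of \<nu>]
    have d: "(frobenius \<nu> P1 Q1 has_real_derivative
        ((\<nu>\<^sup>2 - t\<^sup>2) * frobenius \<nu> P Q t + 2 * \<nu> * ((t / 2) powr \<nu> * P ((t / 2)\<^sup>2))) / t) (at t)"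
      by simp
    show "((\<lambda>t. frobenius \<nu> P1 Q1 t / t) has_real_derivative
        - (frobenius \<nu> P1 Q1 t / t / t) - (1 - \<nu>\<^sup>2 / t\<^sup>2) * frobenius \<nu> P Q t
          + 2 * \<nu> / t\<^sup>2 * ((t / 2) powr \<nu> * P ((t / 2)\<^sup>2))) (at t)"
      by (rule DERIV_cong[OF DERIV_divide[OF d DERIV_ident]])
         (use t in \<open>simp_all add: field_simps power2_eq_square\<close>)
  qed
qed

text \<open>
  Coefficients of \<open>J\<close> in the variable \<open>(t / 2)\<^sup>2\<close>, without the factor \<open>(t / 2) powr \<mu>\<close>. The suffix
  \<open>dorder\<close> marks derivatives with respect to the order \<open>\<mu>\<close>.
\<close>

definition bessel_coeff :: "real \<Rightarrow> nat \<Rightarrow> real" where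
  "bessel_coeff \<mu> m = (- 1) ^ m * rGamma (real m + \<mu> + 1) / fact m"

definition bessel_coeff_dorder :: "real \<Rightarrow> nat \<Rightarrow> real" where
  "bessel_coeff_dorder \<mu> m = (- 1) ^ m * deriv rGamma (real m + \<mu> + 1) / fact m"

lemma deriv_rGamma: "(rGamma has_real_derivative deriv rGamma z) (at z)" for z :: real
  using has_field_derivative_rGamma[of z] DERIV_imp_deriv[OF has_field_derivative_rGamma[of z]] by simp

lemma bessel_coeff_deriv:
  "((\<lambda>\<mu>. bessel_coeff \<mu> m) has_real_derivative bessel_coeff_dorder \<mu> m) (at \<mu>)"
proof -
  have "((\<lambda>\<mu>. rGamma (real m + \<mu> + 1)) has_real_derivative deriv rGamma (real m + \<mu> + 1) * 1) (at \<mu>)"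
    by (rule DERIV_chain2[OF deriv_rGamma]) (auto intro!: derivative_eq_intros)
  then have "((\<lambda>\<mu>. (- 1) ^ m / fact m * rGamma (real m + \<mu> + 1)) has_real_derivative
      (- 1) ^ m / fact m * (deriv rGamma (real m + \<mu> + 1) * 1)) (at \<mu>)"
    by (rule DERIV_cmult)
  then show ?thesis by (simp add: bessel_coeff_def bessel_coeff_dorder_def)
qed

text \<open>
  The functional equation of the reciprocal Gamma function. Written without division it also holds at
  its zeros.
\<close>

lemma bessel_coeff_Suc:
  "(real m + 1) * (real m + 1 + \<mu>) * bessel_coeff \<mu> (Suc m) = - bessel_coeff \<mu> m"
proof -
  define z where "z = real m + 1 + \<mu>"
  have c: "bessel_coeff \<mu> (Suc m) = - ((- 1) ^ m * rGamma (z + 1) / fact m) / (real m + 1)"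
    by (simp add: bessel_coeff_def z_def add_ac mult.commute)
  have "(real m + 1) * z * bessel_coeff \<mu> (Suc m) = - ((- 1) ^ m * (z * rGamma (z + 1)) / fact m)"
    unfolding c by simp
  also have "\<dots> = - bessel_coeff \<mu> m"
    unfolding rGamma_plus1 by (simp add: bessel_coeff_def z_def add_ac)
  finally show ?thesis unfolding z_def .
qed

text \<open>
  The derivative of the recurrence \<open>bessel_coeff_Suc\<close> with respect to \<open>\<mu>\<close>.
\<close>

lemma bessel_coeff_dorder_Suc:
  "(real m + 1) * (real m + 1 + \<mu>) * bessel_coeff_dorder \<mu> (Suc m) + (real m + 1) * bessel_coeff \<mu> (Suc m)
    = - bessel_coeff_dorder \<mu> m"
proof -
  have "((\<lambda>\<mu>. (real m + 1) * (real m + 1 + \<mu>) * bessel_coeff \<mu> (Suc m)) has_real_derivative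
     (real m + 1) * (real m + 1 + \<mu>) * bessel_coeff_dorder \<mu> (Suc m) + (real m + 1) * bessel_coeff \<mu> (Suc m)) (at \<mu>)"
    by (auto intro!: derivative_eq_intros bessel_coeff_deriv)
  moreover have "((\<lambda>\<mu>. - bessel_coeff \<mu> m) has_real_derivative - bessel_coeff_dorder \<mu> m) (at \<mu>)"
    by (intro derivative_intros bessel_coeff_deriv)
  ultimately show ?thesis unfolding bessel_coeff_Suc by (rule DERIV_unique)
qed

text \<open>
  A bound that is uniform for orders near \<open>\<nu>\<close>. Once \<open>m + 1 + \<mu> \<ge> 1\<close> the two recurrences show that
  \<open>\<bar>bessel_coeff \<mu> m\<bar> + \<bar>bessel_coeff_dorder \<mu> m\<bar>\<close> grows by a factor of at most \<open>2 / (m + 1)\<close> from \<open>m\<close>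
  to \<open>m + 1\<close>, so only one index needs a compactness argument, and there the arguments of the Gamma
  function are positive.
\<close>

lemma bessel_coeff_bound:
  obtains K N where "\<And>m \<mu>. m \<ge> N \<Longrightarrow> \<bar>\<mu> - \<nu>\<bar> \<le> 1 \<Longrightarrow>
    \<bar>bessel_coeff \<mu> m\<bar> + \<bar>bessel_coeff_dorder \<mu> m\<bar> \<le> K * 2 ^ m / fact m"
proof -
  define N where "N = nat \<lceil>1 - \<nu>\<rceil>"
  have N: "1 \<le> real N + \<nu>" unfolding N_def by linarith
  define S where "S \<mu> m = \<bar>bessel_coeff \<mu> m\<bar> + \<bar>bessel_coeff_dorder \<mu> m\<bar>" for \<mu> m
  have pos: "z \<notin> \<int>\<^sub>\<le>\<^sub>0" if "z > 0" for z :: real using that by (auto elim!: nonpos_Ints_cases')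
  have der: "deriv rGamma z = - rGamma z * Digamma z" if "z > 0" for z :: real
    by (rule DERIV_imp_deriv[OF has_field_derivative_rGamma_no_nonpos_int[OF pos[OF that]]])
  define h where "h z = \<bar>rGamma z\<bar> + \<bar>- rGamma z * Digamma z\<bar>" for z :: real
  have "continuous_on {real N + \<nu>..real N + \<nu> + 2} h"
    unfolding h_def[abs_def] using N pos
    by (intro continuous_intros continuous_on_Polygamma) force
  then have "bounded (h ` {real N + \<nu>..real N + \<nu> + 2})"
    by (intro compact_imp_bounded compact_continuous_image) auto
  then obtain K0 where bound: "\<And>x. x \<in> h ` {real N + \<nu>..real N + \<nu> + 2} \<Longrightarrow> norm x \<le> K0"
    unfolding bounded_iff by blast
  have K0: "h z \<le> K0" if "z \<in> {real N + \<nu>..real N + \<nu> + 2}" for z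
    using bound[of "h z"] that by simp
  have start: "S \<mu> N \<le> K0 / fact N" if "\<bar>\<mu> - \<nu>\<bar> \<le> 1" for \<mu>
  proof -
    define z where "z = real N + \<mu> + 1"
    have z: "z \<in> {real N + \<nu>..real N + \<nu> + 2}" using that by (auto simp: z_def)
    then have "z > 0" using N by auto
    have "S \<mu> N = h z / fact N"
      unfolding S_def h_def bessel_coeff_def bessel_coeff_dorder_def z_def[symmetric] der[OF \<open>z > 0\<close>]
      by (simp add: abs_mult power_abs add_divide_distrib)
    then show ?thesis using K0[OF z] by (simp add: divide_right_mono)
  qed
  have ratio: "S \<mu> (Suc m) \<le> 2 / real (Suc m) * S \<mu> m" if "m \<ge> N" "\<bar>\<mu> - \<nu>\<bar> \<le> 1" for m \<mu>
  proof -
    define a where "a = (real m + 1) * bessel_coeff \<mu> (Suc m)"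
    define b where "b = (real m + 1) * bessel_coeff_dorder \<mu> (Suc m)"
    define q where "q = real m + 1 + \<mu>"
    have q: "q \<ge> 1" using that N by (simp add: q_def)
    have shrink: "\<bar>x\<bar> \<le> \<bar>q * x\<bar>" for x
      unfolding abs_mult using q mult_right_mono[of 1 "\<bar>q\<bar>" "\<bar>x\<bar>"] by simp
    have a: "q * a = - bessel_coeff \<mu> m"
      using bessel_coeff_Suc[of m \<mu>] by (simp add: a_def q_def mult_ac)
    have b: "q * b + a = - bessel_coeff_dorder \<mu> m"
      using bessel_coeff_dorder_Suc[of m \<mu>] by (simp add: a_def b_def q_def mult_ac)
    have "\<bar>a\<bar> \<le> \<bar>bessel_coeff \<mu> m\<bar>" using shrink[of a] a by simp
    moreover have "\<bar>b\<bar> \<le> \<bar>bessel_coeff_dorder \<mu> m\<bar> + \<bar>a\<bar>" using shrink[of b] b by linarith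
    ultimately have "\<bar>a\<bar> + \<bar>b\<bar> \<le> 2 * S \<mu> m" by (simp add: S_def)
    moreover have "\<bar>a\<bar> + \<bar>b\<bar> = real (Suc m) * S \<mu> (Suc m)"
      unfolding a_def b_def S_def abs_mult by (simp add: distrib_left add.commute)
    ultimately show ?thesis by (simp add: field_simps)
  qed
  have "S \<mu> m \<le> (K0 / 2 ^ N) * 2 ^ m / fact m" if "m \<ge> N" "\<bar>\<mu> - \<nu>\<bar> \<le> 1" for m \<mu>
    using that(1)
  proof (induction rule: dec_induct)
    case base
    then show ?case using start[OF that(2)] by simp
  next
    case (step m)
    have "S \<mu> (Suc m) \<le> 2 / real (Suc m) * S \<mu> m" using step.hyps that(2) by (intro ratio) auto
    also have "\<dots> \<le> 2 / real (Suc m) * ((K0 / 2 ^ N) * 2 ^ m / fact m)"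
      using step.IH by (intro mult_left_mono) auto
    also have "\<dots> = (K0 / 2 ^ N) * 2 ^ Suc m / fact (Suc m)" by (simp add: field_simps)
    finally show ?case .
  qed
  then show thesis unfolding S_def by (rule that)
qed

lemma bessel_coeff_majorant:
  obtains M where "summable M"
    "\<forall>\<^sub>F m in sequentially. \<forall>\<mu>\<in>{\<nu> - 1..\<nu> + 1}. \<bar>bessel_coeff \<mu> m * z ^ m\<bar> \<le> M m \<and> \<bar>bessel_coeff_dorder \<mu> m * z ^ m\<bar> \<le> M m"
proof -
  obtain K N where KN: "\<And>m \<mu>. m \<ge> N \<Longrightarrow> \<bar>\<mu> - \<nu>\<bar> \<le> 1 \<Longrightarrow>
    \<bar>bessel_coeff \<mu> m\<bar> + \<bar>bessel_coeff_dorder \<mu> m\<bar> \<le> K * 2 ^ m / fact m"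
    using bessel_coeff_bound by blast
  define M where "M m = K * (inverse (fact m) * (2 * \<bar>z\<bar>) ^ m)" for m
  have "summable M" unfolding M_def[abs_def] by (intro summable_mult summable_exp)
  moreover have "\<bar>bessel_coeff \<mu> m * z ^ m\<bar> \<le> M m \<and> \<bar>bessel_coeff_dorder \<mu> m * z ^ m\<bar> \<le> M m"
    if "m \<ge> N" "\<mu> \<in> {\<nu> - 1..\<nu> + 1}" for m \<mu>
  proof -
    have *: "\<bar>bessel_coeff \<mu> m\<bar> + \<bar>bessel_coeff_dorder \<mu> m\<bar> \<le> K * 2 ^ m / fact m"
      using that by (intro KN) auto
    have "\<bar>c * z ^ m\<bar> \<le> M m" if "\<bar>c\<bar> \<le> K * 2 ^ m / fact m" for c
      using mult_right_mono[OF that, of "\<bar>z\<bar> ^ m"]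
      by (simp add: M_def abs_mult power_abs power_mult_distrib field_simps)
    with * show ?thesis by simp
  qed
  ultimately show thesis by (intro that[of M]) (auto simp: eventually_sequentially intro!: exI[of _ N])
qed

lemma summable_bessel_coeff:
  "summable (\<lambda>m. bessel_coeff \<mu> m * z ^ m)" "summable (\<lambda>m. bessel_coeff_dorder \<mu> m * z ^ m)"
proof -
  obtain M where M: "summable M" "\<forall>\<^sub>F m in sequentially. \<forall>\<mu>'\<in>{\<mu> - 1..\<mu> + 1}.
      \<bar>bessel_coeff \<mu>' m * z ^ m\<bar> \<le> M m \<and> \<bar>bessel_coeff_dorder \<mu>' m * z ^ m\<bar> \<le> M m"
    by (rule bessel_coeff_majorant)
  show "summable (\<lambda>m. bessel_coeff \<mu> m * z ^ m)" "summable (\<lambda>m. bessel_coeff_dorder \<mu> m * z ^ m)"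
    by (rule summable_comparison_test_ev[OF eventually_mono[OF M(2)] M(1)]; simp)+
qed

definition bessel_entire :: "real \<Rightarrow> real \<Rightarrow> real" where
  "bessel_entire \<mu> z = (\<Sum>m. bessel_coeff \<mu> m * z ^ m)"

definition bessel_entire_dorder :: "real \<Rightarrow> real \<Rightarrow> real" where
  "bessel_entire_dorder \<mu> z = (\<Sum>m. bessel_coeff_dorder \<mu> m * z ^ m)"

text \<open>
  The majorants are uniform in the order, so the series may be differentiated term by term.
\<close>

lemma bessel_entire_deriv_order:
  "((\<lambda>\<mu>. bessel_entire \<mu> z) has_real_derivative bessel_entire_dorder \<nu> z) (at \<nu>)"
proof -
  obtain M where M: "summable M" "\<forall>\<^sub>F m in sequentially. \<forall>\<mu>\<in>{\<nu> - 1..\<nu> + 1}.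
      \<bar>bessel_coeff \<mu> m * z ^ m\<bar> \<le> M m \<and> \<bar>bessel_coeff_dorder \<mu> m * z ^ m\<bar> \<le> M m"
    by (rule bessel_coeff_majorant[of \<nu> z])
  show ?thesis
    unfolding bessel_entire_def bessel_entire_dorder_def
  proof (rule has_field_derivative_series'(2)[of "{\<nu> - 1..\<nu> + 1}" _ _ \<nu>])
    show "((\<lambda>\<mu>. bessel_coeff \<mu> m * z ^ m) has_real_derivative bessel_coeff_dorder \<mu> m * z ^ m) (at \<mu> within {\<nu> - 1..\<nu> + 1})" for m \<mu>
      by (intro DERIV_cmult_right has_field_derivative_at_within[OF bessel_coeff_deriv])
    show "uniformly_convergent_on {\<nu> - 1..\<nu> + 1} (\<lambda>n \<mu>. \<Sum>i<n. bessel_coeff_dorder \<mu> i * z ^ i)"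
      using M by (intro Weierstrass_m_test'_ev[of _ _ M]) (auto elim: eventually_mono)
  qed (auto simp: summable_bessel_coeff)
qed

section \<open>The Bessel functions as nonzero solutions\<close>

lemma solves_bessel_iff_forced: "solves_bessel \<nu> f f' \<longleftrightarrow> forced_bessel \<nu> (\<lambda>_. 0) f f'"
  by (simp add: solves_bessel_def forced_bessel_def)

lemma forced_bessel_cong:
  assumes "forced_bessel \<nu> r f f'" "\<mu>\<^sup>2 = \<nu>\<^sup>2" "\<And>t. t > 0 \<Longrightarrow> g t = f t" "\<And>t. t > 0 \<Longrightarrow> s t = r t"
  shows "forced_bessel \<mu> s g f'"
  unfolding forced_bessel_def
proof (intro allI impI conjI)
  fix t :: real assume t: "t > 0"
  have "(f has_real_derivative f' t) (at t)"
    using assms(1) t by (auto simp: forced_bessel_def)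
  then show "(g has_real_derivative f' t) (at t)"
    by (rule has_field_derivative_transform_within_open[of _ _ _ "{0<..}"]) (use t assms(3) in auto)
  show "(f' has_real_derivative - (f' t / t) - (1 - \<mu>\<^sup>2 / t\<^sup>2) * g t + s t) (at t)"
    using assms(1) t by (simp add: forced_bessel_def assms)
qed

lemma forced_bessel_combine:
  assumes f: "forced_bessel \<nu> r f f'" and g: "forced_bessel \<nu> s g g'"
  shows "forced_bessel \<nu> (\<lambda>t. a * r t + b * s t) (\<lambda>t. a * f t + b * g t) (\<lambda>t. a * f' t + b * g' t)"
  unfolding forced_bessel_def
proof (intro allI impI conjI)
  fix t :: real assume t: "t > 0"
  have df: "(f has_real_derivative f' t) (at t)"
    "(f' has_real_derivative - (f' t / t) - (1 - \<nu>\<^sup>2 / t\<^sup>2) * f t + r t) (at t)"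
    and dg: "(g has_real_derivative g' t) (at t)"
    "(g' has_real_derivative - (g' t / t) - (1 - \<nu>\<^sup>2 / t\<^sup>2) * g t + s t) (at t)"
    using f g t by (auto simp: forced_bessel_def)
  show "((\<lambda>t. a * f t + b * g t) has_real_derivative a * f' t + b * g' t) (at t)"
    by (intro DERIV_add DERIV_cmult df dg)
  show "((\<lambda>t. a * f' t + b * g' t) has_real_derivative - ((a * f' t + b * g' t) / t)
     - (1 - \<nu>\<^sup>2 / t\<^sup>2) * (a * f t + b * g t) + (a * r t + b * s t)) (at t)"
    by (rule DERIV_cong[OF DERIV_add[OF DERIV_cmult[OF df(2)] DERIV_cmult[OF dg(2)]]])
       (simp add: algebra_simps add_divide_distrib)
qed

text \<open>
  Comparison of coefficients for the equations of \<open>frobenius_forced_bessel\<close>; the equation without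
  logarithmic part is the case \<open>a = (\<lambda>_. 0)\<close>.
\<close>

lemma powser_bessel_eq:
  fixes a b :: "nat \<Rightarrow> real"
  assumes b: "\<And>z. summable (\<lambda>m. b m * z ^ m)" and a: "\<And>z. summable (\<lambda>m. a m * z ^ m)"
    and rec: "\<And>m. (real m + 1 + \<nu>) * diffs b m + b m + diffs a m = 0"
  shows "z * (\<Sum>m. diffs (diffs b) m * z ^ m) + (\<nu> + 1) * (\<Sum>m. diffs b m * z ^ m)
    + (\<Sum>m. b m * z ^ m) + (\<Sum>m. diffs a m * z ^ m) = 0"
proof -
  have db: "summable (\<lambda>m. diffs b m * z ^ m)" for z by (rule termdiff_converges_all[OF b])
  have ddb: "summable (\<lambda>m. diffs (diffs b) m * z ^ m)" by (rule termdiff_converges_all[OF db])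
  have da: "summable (\<lambda>m. diffs a m * z ^ m)" by (rule termdiff_converges_all[OF a])
  have "(\<lambda>m. z * (of_nat m * diffs b m * z ^ (m - Suc 0))) sums (z * (\<Sum>m. diffs (diffs b) m * z ^ m))"
    by (intro sums_mult diffs_equiv ddb)
  also have "(\<lambda>m. z * (of_nat m * diffs b m * z ^ (m - Suc 0))) = (\<lambda>m. of_nat m * diffs b m * z ^ m)"
  proof
    show "z * (of_nat m * diffs b m * z ^ (m - Suc 0)) = of_nat m * diffs b m * z ^ m" for m
      by (cases m) auto
  qed
  finally have "(\<lambda>m. of_nat m * diffs b m * z ^ m + (\<nu> + 1) * (diffs b m * z ^ m) + b m * z ^ m + diffs a m * z ^ m)
    sums (z * (\<Sum>m. diffs (diffs b) m * z ^ m) + (\<nu> + 1) * (\<Sum>m. diffs b m * z ^ m)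
    + (\<Sum>m. b m * z ^ m) + (\<Sum>m. diffs a m * z ^ m))"
    by (intro sums_add sums_mult summable_sums db da b)
  moreover have "of_nat m * diffs b m * z ^ m + (\<nu> + 1) * (diffs b m * z ^ m) + b m * z ^ m + diffs a m * z ^ m = 0" for m
  proof -
    have "of_nat m * diffs b m * z ^ m + (\<nu> + 1) * (diffs b m * z ^ m) + b m * z ^ m + diffs a m * z ^ m
      = ((real m + 1 + \<nu>) * diffs b m + b m + diffs a m) * z ^ m" by (simp add: algebra_simps)
    then show ?thesis by (simp add: rec)
  qed
  ultimately show ?thesis by (simp add: sums_unique2[OF _ sums_zero])
qed

lemma powser_derivs:
  fixes c :: "nat \<Rightarrow> real"
  assumes "\<And>z. summable (\<lambda>m. c m * z ^ m)"
  shows "((\<lambda>z. \<Sum>m. c m * z ^ m) has_real_derivative (\<Sum>m. diffs c m * z ^ m)) (at z)"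
    and "((\<lambda>z. \<Sum>m. diffs c m * z ^ m) has_real_derivative (\<Sum>m. diffs (diffs c) m * z ^ m)) (at z)"
  by (intro termdiffs_strong_converges_everywhere termdiff_converges_all assms)+

lemma frobenius_bessel_entire:
  "\<exists>y'. forced_bessel \<nu> (\<lambda>_. 0) (frobenius \<nu> (\<lambda>_. 0) (bessel_entire \<nu>)) y'"
proof -
  have "\<exists>y'. forced_bessel \<nu> (\<lambda>t. 2 * \<nu> / t\<^sup>2 * ((t / 2) powr \<nu> * 0)) (frobenius \<nu> (\<lambda>_. 0) (bessel_entire \<nu>)) y'"
  proof (rule frobenius_forced_bessel[where P = "\<lambda>_. 0" and P' = "\<lambda>_. 0" and P'' = "\<lambda>_. 0"])
    fix z
    show "(bessel_entire \<nu> has_real_derivative (\<Sum>m. diffs (bessel_coeff \<nu>) m * z ^ m)) (at z)"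
      "((\<lambda>z. \<Sum>m. diffs (bessel_coeff \<nu>) m * z ^ m) has_real_derivative
        (\<Sum>m. diffs (diffs (bessel_coeff \<nu>)) m * z ^ m)) (at z)"
      unfolding bessel_entire_def[abs_def] by (intro powser_derivs summable_bessel_coeff)+
    have "(real m + 1 + \<nu>) * diffs (bessel_coeff \<nu>) m + bessel_coeff \<nu> m + diffs (\<lambda>_. 0) m = 0" for m
      using bessel_coeff_Suc[of m \<nu>] by (simp add: diffs_def mult_ac add_ac)
    from powser_bessel_eq[OF summable_bessel_coeff(1) _ this, of z]
    show "z * (\<Sum>m. diffs (diffs (bessel_coeff \<nu>)) m * z ^ m)
        + (\<nu> + 1) * (\<Sum>m. diffs (bessel_coeff \<nu>) m * z ^ m) + bessel_entire \<nu> z + 0 = 0"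
      by (simp add: bessel_entire_def diffs_def)
  qed auto
  then show ?thesis by simp
qed

text \<open>
  The derivative of \<open>J\<close> with respect to the order, see \<open>bessel_J_deriv_order\<close>.
\<close>

definition bessel_J_dorder :: "real \<Rightarrow> real \<Rightarrow> real" where
  "bessel_J_dorder \<nu> = frobenius \<nu> (bessel_entire \<nu>) (bessel_entire_dorder \<nu>)"

lemma forced_bessel_J_dorder:
  "\<exists>y'. forced_bessel \<nu> (\<lambda>t. 2 * \<nu> / t\<^sup>2 * ((t / 2) powr \<nu> * bessel_entire \<nu> ((t / 2)\<^sup>2))) (bessel_J_dorder \<nu>) y'"
  unfolding bessel_J_dorder_def
proof (rule frobenius_forced_bessel)
  fix z
  show "(bessel_entire \<nu> has_real_derivative (\<Sum>m. diffs (bessel_coeff \<nu>) m * z ^ m)) (at z)"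
    "((\<lambda>z. \<Sum>m. diffs (bessel_coeff \<nu>) m * z ^ m) has_real_derivative
        (\<Sum>m. diffs (diffs (bessel_coeff \<nu>)) m * z ^ m)) (at z)"
    "(bessel_entire_dorder \<nu> has_real_derivative (\<Sum>m. diffs (bessel_coeff_dorder \<nu>) m * z ^ m)) (at z)"
    "((\<lambda>z. \<Sum>m. diffs (bessel_coeff_dorder \<nu>) m * z ^ m) has_real_derivative
        (\<Sum>m. diffs (diffs (bessel_coeff_dorder \<nu>)) m * z ^ m)) (at z)"
    unfolding bessel_entire_def[abs_def] bessel_entire_dorder_def[abs_def]
    by (intro powser_derivs summable_bessel_coeff)+
  have "(real m + 1 + \<nu>) * diffs (bessel_coeff \<nu>) m + bessel_coeff \<nu> m + diffs (\<lambda>_. 0) m = 0" for m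
    using bessel_coeff_Suc[of m \<nu>] by (simp add: diffs_def mult_ac add_ac)
  from powser_bessel_eq[OF summable_bessel_coeff(1) _ this, of z]
  show "z * (\<Sum>m. diffs (diffs (bessel_coeff \<nu>)) m * z ^ m)
      + (\<nu> + 1) * (\<Sum>m. diffs (bessel_coeff \<nu>) m * z ^ m) + bessel_entire \<nu> z = 0"
    by (simp add: bessel_entire_def diffs_def)
  have "(real m + 1 + \<nu>) * diffs (bessel_coeff_dorder \<nu>) m + bessel_coeff_dorder \<nu> m + diffs (bessel_coeff \<nu>) m = 0" for m
    using bessel_coeff_dorder_Suc[of m \<nu>] by (simp add: diffs_def mult_ac add_ac)
  from powser_bessel_eq[OF summable_bessel_coeff(2) summable_bessel_coeff(1) this, of z]
  show "z * (\<Sum>m. diffs (diffs (bessel_coeff_dorder \<nu>)) m * z ^ m)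
      + (\<nu> + 1) * (\<Sum>m. diffs (bessel_coeff_dorder \<nu>) m * z ^ m) + bessel_entire_dorder \<nu> z
      + (\<Sum>m. diffs (bessel_coeff \<nu>) m * z ^ m) = 0"
    by (simp add: bessel_entire_dorder_def)
qed

lemma bessel_J_eq:
  assumes "t > 0"
  shows "bessel_J \<nu> t = (t / 2) powr \<nu> * bessel_entire \<nu> ((t / 2)\<^sup>2)"
proof -
  have "(t / 2) powr (2 * real m + \<nu>) = (t / 2) powr \<nu> * ((t / 2)\<^sup>2) ^ m" for m
  proof -
    have "(t / 2) powr (2 * real m) = (t / 2) ^ (2 * m)"
      using assms powr_realpow[of "t / 2" "2 * m"] by simp
    then show ?thesis by (simp add: powr_add power_mult)
  qed
  then have "bessel_J \<nu> t = (\<Sum>m. (t / 2) powr \<nu> * (bessel_coeff \<nu> m * ((t / 2)\<^sup>2) ^ m))"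
    unfolding bessel_J_def bessel_coeff_def by (simp only: mult_ac)
  also have "\<dots> = (t / 2) powr \<nu> * bessel_entire \<nu> ((t / 2)\<^sup>2)"
    unfolding bessel_entire_def by (rule suminf_mult[OF summable_bessel_coeff(1)])
  finally show ?thesis .
qed

lemma bessel_J_solves: "\<exists>y'. solves_bessel \<nu> (bessel_J \<nu>) y'"
proof -
  obtain y' where "forced_bessel \<nu> (\<lambda>_. 0) (frobenius \<nu> (\<lambda>_. 0) (bessel_entire \<nu>)) y'"
    using frobenius_bessel_entire by blast
  then have "forced_bessel \<nu> (\<lambda>_. 0) (bessel_J \<nu>) y'"
    by (rule forced_bessel_cong) (simp_all add: frobenius_def bessel_J_eq)
  then show ?thesis unfolding solves_bessel_iff_forced by blast
qed

text \<open>
  The reciprocal Gamma function kills the first \<open>n\<close> coefficients at order \<open>- n\<close>; the remaining ones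
  are those at order \<open>n\<close>, shifted by \<open>n\<close>.
\<close>

lemma bessel_entire_minus_nat: "bessel_entire (- real n) z = (- 1) ^ n * z ^ n * bessel_entire (real n) z"
proof -
  have low: "bessel_coeff (- real n) m = 0" if "m < n" for m
  proof -
    have eq: "real m + - real n + 1 = - real (n - Suc m)" using that by (simp add: of_nat_diff)
    have "rGamma (real m + - real n + 1) = 0" unfolding eq rGamma_eq_zero_iff by simp
    then show ?thesis by (simp add: bessel_coeff_def)
  qed
  have fac: "rGamma (real k + 1) = 1 / fact k" for k
    using Gamma_fact[of k, where 'a = real] by (simp add: rGamma_inverse_Gamma add_ac inverse_eq_divide)
  have shift: "bessel_coeff (- real n) (k + n) = (- 1) ^ n * bessel_coeff (real n) k" for k
    using fac[of k] fac[of "k + n"] by (simp add: bessel_coeff_def power_add add_ac mult.commute)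
  have "bessel_entire (- real n) z = (\<Sum>k. bessel_coeff (- real n) (k + n) * z ^ (k + n))
      + (\<Sum>m<n. bessel_coeff (- real n) m * z ^ m)"
    unfolding bessel_entire_def by (rule suminf_split_initial_segment[OF summable_bessel_coeff(1)])
  also have "(\<Sum>m<n. bessel_coeff (- real n) m * z ^ m) = 0" by (simp add: low)
  also have "(\<lambda>k. bessel_coeff (- real n) (k + n) * z ^ (k + n))
      = (\<lambda>k. (- 1) ^ n * z ^ n * (bessel_coeff (real n) k * z ^ k))"
    by (simp add: shift power_add mult_ac)
  also have "(\<Sum>k. (- 1) ^ n * z ^ n * (bessel_coeff (real n) k * z ^ k)) = (- 1) ^ n * z ^ n * bessel_entire (real n) z"
    unfolding bessel_entire_def by (rule suminf_mult[OF summable_bessel_coeff(1)])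
  finally show ?thesis by simp
qed

lemma bessel_J_minus_nat:
  assumes "t > 0"
  shows "bessel_J (- real n) t = (- 1) ^ n * bessel_J (real n) t"
proof -
  have "((t / 2)\<^sup>2) ^ n = (t / 2) powr real n * (t / 2) powr real n"
    using assms by (simp only: powr_realpow half_gt_zero flip: power_mult power_add) (simp add: mult_2)
  then have "(t / 2) powr (- real n) * ((t / 2)\<^sup>2) ^ n = (t / 2) powr real n"
    using assms by (simp add: powr_minus field_simps)
  then show ?thesis
    using assms by (simp add: bessel_J_eq bessel_entire_minus_nat mult_ac)
qed

lemma cos_pi_Ints:
  assumes "\<nu> \<in> \<int>"
  shows "sin (\<nu> * pi) = 0" "(cos (\<nu> * pi))\<^sup>2 = 1"
proof -
  show s: "sin (\<nu> * pi) = 0" using assms by (auto simp: sin_zero_iff_int2 elim!: Ints_cases)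
  show "(cos (\<nu> * pi))\<^sup>2 = 1" using sin_cos_squared_add[of "\<nu> * pi"] by (simp add: s)
qed

lemma bessel_J_minus_Ints:
  assumes "\<nu> \<in> \<int>" "t > 0"
  shows "bessel_J (- \<nu>) t = cos (\<nu> * pi) * bessel_J \<nu> t"
proof -
  obtain n where "\<nu> = real n \<or> \<nu> = - real n"
    using assms(1) by (metis Ints_cases int_cases2 of_int_minus of_int_of_nat_eq)
  then show ?thesis
  proof
    assume "\<nu> = - real n"
    then show ?thesis
      using bessel_J_minus_nat[OF assms(2), of n] by (simp add: mult.assoc[symmetric] flip: power_mult_distrib)
  qed (simp add: bessel_J_minus_nat[OF assms(2)])
qed

lemma bessel_J_deriv_order:
  assumes "t > 0"
  shows "((\<lambda>\<mu>. bessel_J \<mu> t) has_real_derivative bessel_J_dorder \<nu> t) (at \<nu>)"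
proof -
  have pw: "((\<lambda>\<mu>. (t / 2) powr \<mu>) has_real_derivative (t / 2) powr \<nu> * ln (t / 2)) (at \<nu>)"
    using assms by (auto intro!: derivative_eq_intros)
  show ?thesis
    unfolding bessel_J_eq[OF assms]
    by (rule DERIV_cong[OF DERIV_mult[OF pw bessel_entire_deriv_order]])
       (simp add: bessel_J_dorder_def frobenius_def algebra_simps)
qed

text \<open>
  Numerator and denominator of the defining quotient vanish at an integer \<open>\<nu>\<close>, so the limit is the
  quotient of their derivatives in the order.
\<close>

lemma bessel_Y_Ints:
  assumes \<nu>: "\<nu> \<in> \<int>" and t: "t > 0"
  shows "bessel_Y \<nu> t = (bessel_J_dorder \<nu> t + cos (\<nu> * pi) * bessel_J_dorder (- \<nu>) t) / pi"
proof -
  define c where "c = cos (\<nu> * pi)"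
  define f where "f \<mu> = bessel_J \<mu> t * cos (\<mu> * pi) - bessel_J (- \<mu>) t" for \<mu>
  have c: "c\<^sup>2 = 1" using cos_pi_Ints(2)[OF \<nu>] by (simp add: c_def)
  then have c0: "c \<noteq> 0" "c * c = 1" by (auto simp: power2_eq_square)
  have f0: "f \<nu> = 0" by (simp add: f_def bessel_J_minus_Ints[OF \<nu> t])
  have Jm: "((\<lambda>\<mu>. bessel_J (- \<mu>) t) has_real_derivative bessel_J_dorder (- \<nu>) t * (- 1)) (at \<nu>)"
    by (rule DERIV_chain2[OF bessel_J_deriv_order[OF t]]) (auto intro!: derivative_eq_intros)
  have cosd: "((\<lambda>\<mu>. cos (\<mu> * pi)) has_real_derivative 0) (at \<nu>)"
    using cos_pi_Ints(1)[OF \<nu>] by (auto intro!: derivative_eq_intros)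
  have df: "(f has_real_derivative c * bessel_J_dorder \<nu> t + bessel_J_dorder (- \<nu>) t) (at \<nu>)"
    unfolding f_def[abs_def]
    by (rule DERIV_cong[OF DERIV_diff[OF DERIV_mult[OF bessel_J_deriv_order[OF t] cosd] Jm]])
       (simp add: c_def)
  have ds: "((\<lambda>\<mu>. sin (\<mu> * pi)) has_real_derivative c * pi) (at \<nu>)"
    unfolding c_def by (auto intro!: derivative_eq_intros)
  have "((\<lambda>\<mu>. ((f \<mu> - f \<nu>) / (\<mu> - \<nu>)) / ((sin (\<mu> * pi) - sin (\<nu> * pi)) / (\<mu> - \<nu>))) \<longlongrightarrow>
      (c * bessel_J_dorder \<nu> t + bessel_J_dorder (- \<nu>) t) / (c * pi)) (at \<nu>)"
    using df ds c0 unfolding has_field_derivative_iff by (intro tendsto_divide) auto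
  then have "((\<lambda>\<mu>. f \<mu> / sin (\<mu> * pi)) \<longlongrightarrow> (c * bessel_J_dorder \<nu> t + bessel_J_dorder (- \<nu>) t) / (c * pi)) (at \<nu>)"
  proof (rule Lim_transform_eventually)
    show "\<forall>\<^sub>F \<mu> in at \<nu>. ((f \<mu> - f \<nu>) / (\<mu> - \<nu>)) / ((sin (\<mu> * pi) - sin (\<nu> * pi)) / (\<mu> - \<nu>)) = f \<mu> / sin (\<mu> * pi)"
      by (auto simp: eventually_at_filter f0 cos_pi_Ints(1)[OF \<nu>])
  qed
  then have "Lim (at \<nu>) (\<lambda>\<mu>. f \<mu> / sin (\<mu> * pi)) = (c * bessel_J_dorder \<nu> t + bessel_J_dorder (- \<nu>) t) / (c * pi)"
    by (intro tendsto_Lim) auto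
  also have "\<dots> = (bessel_J_dorder \<nu> t + c * bessel_J_dorder (- \<nu>) t) / pi"
  proof -
    have "bessel_J_dorder (- \<nu>) t = c * (c * bessel_J_dorder (- \<nu>) t)" by (simp add: c0 flip: mult.assoc)
    then have "c * bessel_J_dorder \<nu> t + bessel_J_dorder (- \<nu>) t = c * (bessel_J_dorder \<nu> t + c * bessel_J_dorder (- \<nu>) t)"
      by (simp add: distrib_left)
    then show ?thesis using c0 by simp
  qed
  finally show ?thesis using \<nu> by (simp add: bessel_Y_def f_def c_def)
qed

text \<open>
  At integer orders the forcing terms of the two derivatives are \<open>2 * \<nu> / t\<^sup>2\<close> times \<open>J\<^sub>\<nu>\<close> and
  \<open>- 2 * \<nu> / t\<^sup>2\<close> times \<open>J\<^sub>-\<^sub>\<nu>\<close>; they cancel by the reflection formula.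
\<close>

lemma bessel_Y_solves: "\<exists>y'. solves_bessel \<nu> (bessel_Y \<nu>) y'"
proof (cases "\<nu> \<in> \<int>")
  case False
  obtain y' where y': "forced_bessel \<nu> (\<lambda>_. 0) (bessel_J \<nu>) y'"
    using bessel_J_solves unfolding solves_bessel_iff_forced by blast
  obtain w' where "forced_bessel (- \<nu>) (\<lambda>_. 0) (bessel_J (- \<nu>)) w'"
    using bessel_J_solves unfolding solves_bessel_iff_forced by blast
  then have w': "forced_bessel \<nu> (\<lambda>_. 0) (bessel_J (- \<nu>)) w'"
    by (rule forced_bessel_cong) auto
  have "forced_bessel \<nu> (\<lambda>_. 0) (bessel_Y \<nu>)
      (\<lambda>t. cos (\<nu> * pi) / sin (\<nu> * pi) * y' t + (- 1 / sin (\<nu> * pi)) * w' t)"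
    by (rule forced_bessel_cong[OF forced_bessel_combine[OF y' w']])
       (use False in \<open>auto simp: bessel_Y_def diff_divide_distrib\<close>)
  then show ?thesis unfolding solves_bessel_iff_forced by blast
next
  case True
  define c where "c = cos (\<nu> * pi)"
  have c: "c * c = 1" using cos_pi_Ints(2)[OF True] by (simp add: c_def power2_eq_square)
  obtain y' where "forced_bessel \<nu> (\<lambda>t. 2 * \<nu> / t\<^sup>2 * ((t / 2) powr \<nu> * bessel_entire \<nu> ((t / 2)\<^sup>2))) (bessel_J_dorder \<nu>) y'"
    using forced_bessel_J_dorder by blast
  then have y': "forced_bessel \<nu> (\<lambda>t. 2 * \<nu> / t\<^sup>2 * bessel_J \<nu> t) (bessel_J_dorder \<nu>) y'"
    by (rule forced_bessel_cong) (auto simp: bessel_J_eq)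
  obtain w' where "forced_bessel (- \<nu>) (\<lambda>t. 2 * (- \<nu>) / t\<^sup>2 * ((t / 2) powr (- \<nu>) * bessel_entire (- \<nu>) ((t / 2)\<^sup>2))) (bessel_J_dorder (- \<nu>)) w'"
    using forced_bessel_J_dorder by blast
  then have w': "forced_bessel \<nu> (\<lambda>t. - 2 * \<nu> / t\<^sup>2 * bessel_J (- \<nu>) t) (bessel_J_dorder (- \<nu>)) w'"
    by (rule forced_bessel_cong) (auto simp: bessel_J_eq)
  have "forced_bessel \<nu> (\<lambda>_. 0) (bessel_Y \<nu>) (\<lambda>t. 1 / pi * y' t + c / pi * w' t)"
  proof (rule forced_bessel_cong[OF forced_bessel_combine[OF y' w']])
    fix t :: real assume t: "t > 0"
    show "bessel_Y \<nu> t = 1 / pi * bessel_J_dorder \<nu> t + c / pi * bessel_J_dorder (- \<nu>) t"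
      by (simp add: bessel_Y_Ints[OF True t] c_def add_divide_distrib)
    have "c * bessel_J (- \<nu>) t = bessel_J \<nu> t"
      by (simp add: bessel_J_minus_Ints[OF True t] c flip: c_def mult.assoc)
    then show "0 = 1 / pi * (2 * \<nu> / t\<^sup>2 * bessel_J \<nu> t) + c / pi * (- 2 * \<nu> / t\<^sup>2 * bessel_J (- \<nu>) t)"
      by (simp add: field_simps)
  qed simp
  then show ?thesis unfolding solves_bessel_iff_forced by blast
qed

lemma bessel_entire_small: "((\<lambda>t. bessel_entire \<mu> ((t / 2)\<^sup>2)) \<longlongrightarrow> rGamma (\<mu> + 1)) (at_right 0)"
  and bessel_entire_dorder_small: "((\<lambda>t. bessel_entire_dorder \<mu> ((t / 2)\<^sup>2)) \<longlongrightarrow> deriv rGamma (\<mu> + 1)) (at_right 0)"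
proof -
  have at_zero: "bessel_entire \<mu> 0 = rGamma (\<mu> + 1)" "bessel_entire_dorder \<mu> 0 = deriv rGamma (\<mu> + 1)"
    unfolding bessel_entire_def bessel_entire_dorder_def powser_zero
    by (simp_all add: bessel_coeff_def bessel_coeff_dorder_def)
  have sq: "((\<lambda>t::real. (t / 2)\<^sup>2) \<longlongrightarrow> 0) (at_right 0)" by (auto intro!: tendsto_eq_intros)
  have cont: "isCont (bessel_entire \<mu>) 0" "isCont (bessel_entire_dorder \<mu>) 0"
    unfolding bessel_entire_def[abs_def] bessel_entire_dorder_def[abs_def]
    by (rule DERIV_isCont[OF powser_derivs(1)], rule summable_bessel_coeff)+
  have "((\<lambda>t. bessel_entire \<mu> ((t / 2)\<^sup>2)) \<longlongrightarrow> bessel_entire \<mu> 0) (at_right 0)"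
    "((\<lambda>t. bessel_entire_dorder \<mu> ((t / 2)\<^sup>2)) \<longlongrightarrow> bessel_entire_dorder \<mu> 0) (at_right 0)"
    by (rule isCont_tendsto_compose[OF cont(1) sq], rule isCont_tendsto_compose[OF cont(2) sq])
  then show "((\<lambda>t. bessel_entire \<mu> ((t / 2)\<^sup>2)) \<longlongrightarrow> rGamma (\<mu> + 1)) (at_right 0)"
    "((\<lambda>t. bessel_entire_dorder \<mu> ((t / 2)\<^sup>2)) \<longlongrightarrow> deriv rGamma (\<mu> + 1)) (at_right 0)"
    by (simp_all add: at_zero)
qed

text \<open>
  The leading coefficient does not vanish at these orders, so \<open>J\<close> behaves like a nonzero multiple of
  \<open>t powr \<mu>\<close> near \<open>0\<close>.
\<close>

lemma bessel_J_nonzero_generic: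
  assumes "\<mu> + 1 \<notin> \<int>\<^sub>\<le>\<^sub>0"
  shows "\<exists>t>0. bessel_J \<mu> t \<noteq> 0"
proof -
  have "rGamma (\<mu> + 1) \<noteq> 0" using assms by (simp add: rGamma_eq_zero_iff)
  with bessel_entire_small have "\<forall>\<^sub>F t in at_right 0. bessel_entire \<mu> ((t / 2)\<^sup>2) \<noteq> 0"
    by (rule tendsto_imp_eventually_ne)
  with eventually_at_right_less[of 0] have "\<forall>\<^sub>F t in at_right 0. 0 < t \<and> bessel_J \<mu> t \<noteq> 0"
    by eventually_elim (auto simp: bessel_J_eq)
  then show ?thesis using eventually_happens'[OF trivial_limit_at_right_real] by blast
qed

lemma bessel_J_nonzero: "\<exists>t>0. bessel_J \<nu> t \<noteq> 0"
proof (cases "\<nu> + 1 \<in> \<int>\<^sub>\<le>\<^sub>0")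
  case False
  then show ?thesis by (rule bessel_J_nonzero_generic)
next
  case True
  then obtain n where n: "\<nu> + 1 = - real n" by (auto elim!: nonpos_Ints_cases')
  then have "\<nu> = - real (Suc n)" by simp
  then have int: "\<nu> \<in> \<int>" by (metis Ints_minus Ints_of_nat)
  have "- \<nu> + 1 \<notin> \<int>\<^sub>\<le>\<^sub>0" using n by (auto elim!: nonpos_Ints_cases')
  then obtain t where "t > 0" "bessel_J (- \<nu>) t \<noteq> 0" using bessel_J_nonzero_generic by blast
  then show ?thesis using bessel_J_minus_Ints[OF int] by auto
qed

lemma powr_half_tendsto_0:
  assumes "a > 0"
  shows "((\<lambda>t::real. (t / 2) powr a) \<longlongrightarrow> 0) (at_right 0)"
proof -
  have "((\<lambda>t::real. (t / 2) powr a) \<longlongrightarrow> 0 powr a) (at_right 0)"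
    using assms by (intro tendsto_powr2) (auto intro!: tendsto_eq_intros simp: eventually_at_right_less eventually_mono[OF eventually_at_right_less])
  then show ?thesis by simp
qed

text \<open>
  If \<open>Y\<close> vanished, \<open>J\<^sub>\<nu>\<close> and \<open>J\<^sub>-\<^sub>\<nu>\<close> would be proportional, but near \<open>0\<close> they behave like
  \<open>t powr \<nu>\<close> and \<open>t powr (- \<nu>)\<close>.
\<close>

lemma bessel_Y_nonzero_nonint:
  assumes \<nu>: "\<nu> \<notin> \<int>"
  shows "\<exists>t>0. bessel_Y \<nu> t \<noteq> 0"
proof (rule ccontr)
  assume "\<not> ?thesis"
  then have zero: "\<And>t. t > 0 \<Longrightarrow> bessel_Y \<nu> t = 0" by blast
  define c where "c = cos (\<nu> * pi)"
  have "sin (\<nu> * pi) \<noteq> 0" using \<nu> by (auto simp: sin_zero_iff_int2)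
  then have J: "c * bessel_J \<nu> t = bessel_J (- \<nu>) t" if "t > 0" for t
    using zero[OF that] \<nu> by (simp add: bessel_Y_def c_def mult.commute)
  have ints: "\<nu> + 1 \<notin> \<int>\<^sub>\<le>\<^sub>0" "- \<nu> + 1 \<notin> \<int>\<^sub>\<le>\<^sub>0"
  proof -
    have "\<nu> \<in> \<int>" if "\<nu> + 1 \<in> \<int>" using Ints_diff[OF that Ints_1] by simp
    then show "\<nu> + 1 \<notin> \<int>\<^sub>\<le>\<^sub>0" using \<nu> nonpos_Ints_Int by blast
    have "\<nu> \<in> \<int>" if "- \<nu> + 1 \<in> \<int>" using Ints_diff[OF Ints_1 that] by simp
    then show "- \<nu> + 1 \<notin> \<int>\<^sub>\<le>\<^sub>0" using \<nu> nonpos_Ints_Int by blast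
  qed
  have nz: "rGamma (\<nu> + 1) \<noteq> 0" "rGamma (- \<nu> + 1) \<noteq> 0" using ints by (simp_all add: rGamma_eq_zero_iff)
  have "\<nu> \<noteq> 0" using \<nu> by auto
  have key: "c * (t / 2) powr (\<nu> + a) * bessel_entire \<nu> ((t / 2)\<^sup>2) = (t / 2) powr (a - \<nu>) * bessel_entire (- \<nu>) ((t / 2)\<^sup>2)"
    if "t > 0" for a t
  proof -
    have p: "(t / 2) powr a * (t / 2) powr \<nu> = (t / 2) powr (\<nu> + a)"
      "(t / 2) powr a * (t / 2) powr (- \<nu>) = (t / 2) powr (a - \<nu>)"
      using powr_add[of "t / 2" a \<nu>] powr_add[of "t / 2" a "- \<nu>"] by (simp_all add: add.commute)
    have "c * ((t / 2) powr a * (t / 2) powr \<nu>) * bessel_entire \<nu> ((t / 2)\<^sup>2) = (t / 2) powr a * (c * bessel_J \<nu> t)"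
      unfolding bessel_J_eq[OF that] by (simp only: mult_ac)
    also have "\<dots> = (t / 2) powr a * (t / 2) powr (- \<nu>) * bessel_entire (- \<nu>) ((t / 2)\<^sup>2)"
      unfolding J[OF that] unfolding bessel_J_eq[OF that] by (simp only: mult_ac)
    finally show ?thesis unfolding p .
  qed
  show False
  proof (cases "\<nu> > 0")
    case True
    have "((\<lambda>t. c * (t / 2) powr (\<nu> + \<nu>) * bessel_entire \<nu> ((t / 2)\<^sup>2)) \<longlongrightarrow> c * 0 * rGamma (\<nu> + 1)) (at_right 0)"
      using True by (intro tendsto_mult tendsto_const bessel_entire_small powr_half_tendsto_0) auto
    moreover have "\<forall>\<^sub>F t in at_right 0. c * (t / 2) powr (\<nu> + \<nu>) * bessel_entire \<nu> ((t / 2)\<^sup>2) = bessel_entire (- \<nu>) ((t / 2)\<^sup>2)"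
      using eventually_at_right_less[of 0] by eventually_elim (use key[of _ \<nu>] in auto)
    ultimately have "((\<lambda>t. bessel_entire (- \<nu>) ((t / 2)\<^sup>2)) \<longlongrightarrow> c * 0 * rGamma (\<nu> + 1)) (at_right 0)"
      by (rule Lim_transform_eventually)
    from tendsto_unique[OF trivial_limit_at_right_real this bessel_entire_small] nz show False by simp
  next
    case False
    with \<open>\<nu> \<noteq> 0\<close> have "\<nu> < 0" by simp
    have "((\<lambda>t. (t / 2) powr (- \<nu> - \<nu>) * bessel_entire (- \<nu>) ((t / 2)\<^sup>2)) \<longlongrightarrow> 0 * rGamma (- \<nu> + 1)) (at_right 0)"
      using \<open>\<nu> < 0\<close> by (intro tendsto_mult tendsto_const bessel_entire_small powr_half_tendsto_0) auto
    moreover have "\<forall>\<^sub>F t in at_right 0. (t / 2) powr (- \<nu> - \<nu>) * bessel_entire (- \<nu>) ((t / 2)\<^sup>2) = c * bessel_entire \<nu> ((t / 2)\<^sup>2)"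
      using eventually_at_right_less[of 0] by eventually_elim (use key[of _ "- \<nu>"] in auto)
    ultimately have "((\<lambda>t. c * bessel_entire \<nu> ((t / 2)\<^sup>2)) \<longlongrightarrow> 0 * rGamma (- \<nu> + 1)) (at_right 0)"
      by (rule Lim_transform_eventually)
    from tendsto_unique[OF trivial_limit_at_right_real this tendsto_mult[OF tendsto_const bessel_entire_small]]
    have "c = 0" using nz by simp
    then show False using J bessel_J_nonzero[of "- \<nu>"] by auto
  qed
qed

text \<open>
  Near \<open>0\<close> the function \<open>Y\<^sub>0\<close> is dominated by its logarithmic term. For \<open>n > 0\<close> the dominating term is
  a multiple of \<open>t powr (- n)\<close>, and its coefficient is nonzero because the zeros of the reciprocal
  Gamma function are simple.
\<close>

lemma bessel_Y_nonzero_nat: "\<exists>t>0. bessel_Y (real n) t \<noteq> 0"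
proof (rule ccontr)
  assume "\<not> ?thesis"
  then have zero: "\<And>t. t > 0 \<Longrightarrow> bessel_Y (real n) t = 0" by blast
  define c where "c = cos (real n * pi)"
  have int: "real n \<in> \<int>" by simp
  have c: "c * c = 1" using cos_pi_Ints(2)[OF int] by (simp add: c_def power2_eq_square)
  then have c0: "c \<noteq> 0" by auto
  have D: "bessel_J_dorder (real n) t + c * bessel_J_dorder (- real n) t = 0" if "t > 0" for t
    using zero[OF that] bessel_Y_Ints[OF int that] by (simp add: c_def)
  show False
  proof (cases "n = 0")
    case True
    have eq: "bessel_entire 0 ((t / 2)\<^sup>2) = - bessel_entire_dorder 0 ((t / 2)\<^sup>2) / ln (t / 2)" if "t > 0" "t < 1" for t
    proof -
      have "ln (t / 2) < 0" using that by simp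
      moreover have "ln (t / 2) * bessel_entire 0 ((t / 2)\<^sup>2) + bessel_entire_dorder 0 ((t / 2)\<^sup>2) = 0"
        using D[OF that(1)] True that by (simp add: c_def bessel_J_dorder_def frobenius_def)
      ultimately show ?thesis by (simp add: field_simps)
    qed
    have half: "filterlim (\<lambda>t::real. t / 2) (at_right 0) (at_right 0)"
      by (auto simp: filterlim_at intro!: tendsto_eq_intros eventually_mono[OF eventually_at_right_less])
    have "filterlim (\<lambda>t::real. ln (t / 2)) at_bot (at_right 0)"
      by (rule filterlim_compose[OF ln_at_0 half])
    then have "filterlim (\<lambda>t::real. ln (t / 2)) at_infinity (at_right 0)"
      by (rule filterlim_at_bot_imp_at_infinity)
    then have "((\<lambda>t. - bessel_entire_dorder 0 ((t / 2)\<^sup>2) / ln (t / 2)) \<longlongrightarrow> 0) (at_right 0)"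
      by (intro tendsto_divide_0[OF tendsto_minus[OF bessel_entire_dorder_small]])
    moreover have "\<forall>\<^sub>F t in at_right 0. - bessel_entire_dorder 0 ((t / 2)\<^sup>2) / ln (t / 2) = bessel_entire 0 ((t / 2)\<^sup>2)"
      unfolding eventually_at_right_field using eq by (intro exI[of _ 1]) auto
    ultimately have "((\<lambda>t. bessel_entire 0 ((t / 2)\<^sup>2)) \<longlongrightarrow> 0) (at_right 0)"
      by (rule Lim_transform_eventually)
    from tendsto_unique[OF trivial_limit_at_right_real this bessel_entire_small] show False by simp
  next
    case False
    define \<nu> where "\<nu> = real n"
    have \<nu>1: "\<nu> \<ge> 1" using False by (simp add: \<nu>_def)
    \<comment> \<open>\<open>h\<close> is \<open>pi * (t / 2) powr \<nu> * Y\<close>, with the logarithmic part of order \<open>- \<nu>\<close> rewritten by the reflection formula\<close>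
    define h where "h t = 2 * (ln (t / 2) * (t / 2) powr (2 * \<nu>)) * bessel_entire \<nu> ((t / 2)\<^sup>2)
      + (t / 2) powr (2 * \<nu>) * bessel_entire_dorder \<nu> ((t / 2)\<^sup>2) + c * bessel_entire_dorder (- \<nu>) ((t / 2)\<^sup>2)" for t
    have h0: "h t = 0" if "t > 0" for t
    proof -
      have J: "c * bessel_J (- \<nu>) t = bessel_J \<nu> t"
        unfolding \<nu>_def bessel_J_minus_Ints[OF int that] c_def[symmetric] mult.assoc[symmetric] c by simp
      have "(t / 2) powr \<nu> * (bessel_J_dorder \<nu> t + c * bessel_J_dorder (- \<nu>) t)
        = (t / 2) powr \<nu> * (ln (t / 2) * (bessel_J \<nu> t + c * bessel_J (- \<nu>) t))
        + (t / 2) powr \<nu> * (t / 2) powr \<nu> * bessel_entire_dorder \<nu> ((t / 2)\<^sup>2)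
        + ((t / 2) powr \<nu> * (t / 2) powr (- \<nu>)) * (c * bessel_entire_dorder (- \<nu>) ((t / 2)\<^sup>2))"
        using that by (simp add: bessel_J_dorder_def frobenius_def bessel_J_eq algebra_simps)
      also have "(t / 2) powr \<nu> * (t / 2) powr (- \<nu>) = 1" using that by (simp add: powr_minus)
      also have "(t / 2) powr \<nu> * (t / 2) powr \<nu> = (t / 2) powr (2 * \<nu>)" by (simp flip: powr_add)
      also have "(t / 2) powr \<nu> * (ln (t / 2) * (bessel_J \<nu> t + c * bessel_J (- \<nu>) t))
          = 2 * (ln (t / 2) * ((t / 2) powr \<nu> * (t / 2) powr \<nu>)) * bessel_entire \<nu> ((t / 2)\<^sup>2)"
        unfolding J using that by (simp add: bessel_J_eq algebra_simps)
      also have "(t / 2) powr \<nu> * (t / 2) powr \<nu> = (t / 2) powr (2 * \<nu>)" by (simp flip: powr_add)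
      finally show ?thesis using D[OF that] by (simp add: h_def \<nu>_def)
    qed
    have log: "((\<lambda>t. ln (t / 2) * (t / 2) powr (2 * \<nu>)) \<longlongrightarrow> 0) (at_right 0)"
    proof (rule Lim_null_comparison)
      show "((\<lambda>t. (t / 2) powr (2 * \<nu> - 1)) \<longlongrightarrow> 0) (at_right 0)"
        using \<nu>1 by (intro powr_half_tendsto_0) auto
      have "norm (ln (t / 2) * (t / 2) powr (2 * \<nu>)) \<le> (t / 2) powr (2 * \<nu> - 1)" if "0 < t" "t < 1" for t
      proof -
        have "ln (t / 2) < 0" using that by simp
        then have "\<bar>ln (t / 2)\<bar> = ln (2 / t)" using that by (simp add: ln_div)
        also have "\<dots> \<le> 2 / t" using that by (intro less_imp_le[OF ln_less_self]) simp
        finally have "\<bar>ln (t / 2)\<bar> * (t / 2) powr (2 * \<nu>) \<le> 2 / t * (t / 2) powr (2 * \<nu>)"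
          by (rule mult_right_mono) simp
        also have "\<dots> = (t / 2) powr (2 * \<nu> - 1)" using that by (simp add: powr_diff)
        finally show ?thesis by (simp add: abs_mult)
      qed
      then show "\<forall>\<^sub>F t in at_right 0. norm (ln (t / 2) * (t / 2) powr (2 * \<nu>)) \<le> (t / 2) powr (2 * \<nu> - 1)"
        unfolding eventually_at_right_field by (intro exI[of _ 1]) auto
    qed
    have "(h \<longlongrightarrow> 2 * 0 * rGamma (\<nu> + 1) + 0 * deriv rGamma (\<nu> + 1) + c * deriv rGamma (- \<nu> + 1)) (at_right 0)"
      unfolding h_def[abs_def] using \<nu>1
      by (intro tendsto_add tendsto_mult tendsto_const log powr_half_tendsto_0 bessel_entire_small bessel_entire_dorder_small) auto
    moreover have "\<forall>\<^sub>F t in at_right 0. h t = 0"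
      using eventually_at_right_less[of 0] by eventually_elim (rule h0)
    then have "(h \<longlongrightarrow> 0) (at_right 0)" by (rule tendsto_eventually)
    ultimately have "c * deriv rGamma (- \<nu> + 1) = 0"
      using tendsto_unique[OF trivial_limit_at_right_real] by fastforce
    moreover have "- \<nu> + 1 = - real (n - 1)" using False by (simp add: \<nu>_def of_nat_diff)
    then have "deriv rGamma (- \<nu> + 1) = (- 1) ^ (n - 1) * fact (n - 1)"
      using DERIV_imp_deriv[OF has_field_derivative_rGamma_nonpos_int[of "n - 1", where 'a = real]] by simp
    ultimately show False using c0 by simp
  qed
qed

text \<open>
  Negative integers reduce to natural numbers, since \<open>Y\<^sub>-\<^sub>n\<close> and \<open>Y\<^sub>n\<close> agree up to the sign
  \<open>cos (n * pi)\<close>.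
\<close>

lemma bessel_Y_nonzero: "\<exists>t>0. bessel_Y \<nu> t \<noteq> 0"
proof (cases "\<nu> \<in> \<int>")
  case False
  then show ?thesis by (rule bessel_Y_nonzero_nonint)
next
  case True
  then obtain n where "\<nu> = real n \<or> \<nu> = - real n"
    by (metis Ints_cases int_cases2 of_int_minus of_int_of_nat_eq)
  then show ?thesis
  proof
    assume \<nu>: "\<nu> = - real n"
    obtain t where t: "t > 0" "bessel_Y (real n) t \<noteq> 0" using bessel_Y_nonzero_nat by blast
    define c where "c = cos (real n * pi)"
    have c: "c * c = 1" using cos_pi_Ints(2)[of "real n"] by (simp add: c_def power2_eq_square)
    have Y: "bessel_Y \<nu> t = (bessel_J_dorder (- real n) t + c * bessel_J_dorder (real n) t) / pi"
      using bessel_Y_Ints[OF True t(1)] by (simp add: \<nu> c_def)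
    have "c * bessel_Y \<nu> t = (c * bessel_J_dorder (- real n) t + (c * c) * bessel_J_dorder (real n) t) / pi"
      unfolding Y by (simp add: algebra_simps)
    also have "\<dots> = bessel_Y (real n) t"
      unfolding c bessel_Y_Ints[OF Ints_of_nat t(1)] c_def[symmetric] by (simp only: mult_1_left add.commute)
    finally show ?thesis using t by (intro exI[of _ t]) auto
  qed (simp add: bessel_Y_nonzero_nat)
qed

theorem corollary1:
  fixes \<nu> \<tau>\<^sub>0 :: real and x :: "real \<Rightarrow> real"
  assumes "\<tau>\<^sub>0 > 0"
    and "(\<forall>t\<ge>\<tau>\<^sub>0. x t = bessel_J \<nu> t) \<or> (\<forall>t\<ge>\<tau>\<^sub>0. x t = bessel_Y \<nu> t)"
  shows "has_phase_dim \<tau>\<^sub>0 x (4 / 3)"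
  using assms(2)
proof
  assume "\<forall>t\<ge>\<tau>\<^sub>0. x t = bessel_J \<nu> t"
  then show ?thesis
    using bessel_J_solves[of \<nu>] bessel_J_nonzero[of \<nu>] assms(1) solves_bessel_phase_dim by blast
next
  assume "\<forall>t\<ge>\<tau>\<^sub>0. x t = bessel_Y \<nu> t"
  then show ?thesis
    using bessel_Y_solves[of \<nu>] bessel_Y_nonzero[of \<nu>] assms(1) solves_bessel_phase_dim by blast
qed

end
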